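(* Let $X$ be a real Banach space with continuous dual $X^*$, and let $A, B\colon X\rightrightarrows X^*$ be maximally monotone operators such that $\operatorname{star}(\operatorname{dom} A)\cap\operatorname{int}\operatorname{dom} B\neq\varnothing$. Assume that $A$ is of type (FPV). Then $A+B$ is maximally monotone.
   Context: $X$ is a real Banach space, $X^*$ its continuous dual, $\langle\cdot,\cdot\rangle$ the duality pairing. A set-valued operator $A\colon X\rightrightarrows X^*$ assigns to each $x\in X$ a (possibly empty) subset $Ax\subseteq X^*$; its graph is $\operatorname{gra}A=\{(x,x^* )\in X\times X^*\mid x^*\in Ax\}$ and its domain is $\operatorname{dom}A=\{x\in X\mid Ax\neq\varnothing\}$. $A$ is monotone if $\langle x-y,x^*-y^*\rangle\ge 0$ for all $(x,x^* ),(y,y^* )\in\operatorname{gra}A$, and maximally monotone if it is monotone and has no proper monotone extension (in the sense of graph inclusion). The sum operator is $(A+B)x=\{a^*+b^*\mid a^*\in Ax,\ b^*\in Bx\}$. A pair $(x,x^* )\in X\times X^*$ is monotonically related to a set $G\subseteq X\times X^*$ if $\langle x-y,x^*-y^*\rangle\ge 0$ for all $(y,y^* )\in G$. A maximally monotone operator $A$ is of type (FPV) if for every open convex set $U\subseteq X$ with $U\cap\operatorname{dom}A\neq\varnothing$: whenever $x\in U$ and $(x,x^* )$ is monotonically related to $\operatorname{gra}A\cap(U\times X^* )$, then $(x,x^* )\in\operatorname{gra}A$. For $C\subseteq X$, $\operatorname{star}C=\{x\in C\mid [x,c]\subseteq C\ \text{for all } c\in C\}$, where $[x,c]=\{tx+(1-t)c\mid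 0\le t\le 1\}$; $\operatorname{int}C$ is the norm interior of $C$, and $\operatorname{int}\operatorname{dom}B$ is the interior of $\operatorname{dom}B$. *)

theory Defs
  imports "HOL-Analysis.Analysis"
begin

text \<open>The continuous dual of a real normed space \<open>'a\<close> is the type of bounded linear functions
  \<open>'a \<Rightarrow>\<^sub>L real\<close>, and the duality pairing is \<open>blinfun_apply\<close>. Set-valued operators may take the
  value \<open>{}\<close>.\<close>

type_synonym 'a set_op = "'a \<Rightarrow> ('a \<Rightarrow>\<^sub>L real) set"

definition gra :: "'a::real_normed_vector set_op \<Rightarrow> ('a \<times> ('a \<Rightarrow>\<^sub>L real)) set" where
  "gra A = {(x, x'). x' \<in> A x}"

definition op_dom :: "'a::real_normed_vector set_op \<Rightarrow> 'a set" where
  "op_dom A = {x. A x \<noteq> {}}"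

definition monotone_op :: "'a::real_normed_vector set_op \<Rightarrow> bool" where
  "monotone_op A \<longleftrightarrow>
    (\<forall>(x, x') \<in> gra A. \<forall>(y, y') \<in> gra A. 0 \<le> blinfun_apply (x' - y') (x - y))"

definition maximally_monotone :: "'a::real_normed_vector set_op \<Rightarrow> bool" where
  "maximally_monotone A \<longleftrightarrow>
    monotone_op A \<and> \<not> (\<exists>B. monotone_op B \<and> gra A \<subset> gra B)"

definition sum_op ::
  "'a::real_normed_vector set_op \<Rightarrow> 'a set_op \<Rightarrow> 'a set_op" where
  "sum_op A B = (\<lambda>x. {a + b | a b. a \<in> A x \<and> b \<in> B x})"

definition monotonically_related ::
  "'a::real_normed_vector \<times> ('a \<Rightarrow>\<^sub>L real) \<Rightarrow> ('a \<times> ('a \<Rightarrow>\<^sub>L real)) set \<Rightarrow> bool" where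
  "monotonically_related = (\<lambda>(x, x') G.
    \<forall>(y, y') \<in> G. 0 \<le> blinfun_apply (x' - y') (x - y))"

definition type_FPV :: "'a::real_normed_vector set_op \<Rightarrow> bool" where
  "type_FPV A \<longleftrightarrow> maximally_monotone A \<and>
    (\<forall>U. open U \<and> convex U \<and> U \<inter> op_dom A \<noteq> {} \<longrightarrow>
      (\<forall>x x'. x \<in> U \<and> monotonically_related (x, x') (gra A \<inter> (U \<times> UNIV)) \<longrightarrow>
        (x, x') \<in> gra A))"

definition star_of_set :: "'a::real_vector set \<Rightarrow> 'a set" where
  "star_of_set C = {x \<in> C. \<forall>c \<in> C. closed_segment x c \<subseteq> C}"

end

(*
Translate so that 0 lies in star(dom A) and int(dom B), with 0 in A 0 and B bounded near 0. Let (z, z')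
be monotonically related to gra(A + B).

(1) The Fitzpatrick function of A + B dominates the pairing. Otherwise <z - y, z' - a - b> >= e > 0 on
the whole graph. On the drop T = conv({z} \<union> ball 0 r) without its apex, <z - y, b> is bounded below
by -K |z - y|, and testing type (FPV) on T at s z with s -> 1 gives a contradiction, provided that
dom A meets T only inside dom B. If it did not, the star property would give a point y of dom A in T
on the boundary of dom B. If B y is nonempty, adding large normal vectors to B y is contradictory.
If B y is empty, test type (FPV) at points of int(dom B) converging to y along the segment towards a
small multiple of z: this yields points of gra A near y whose pairing with z is bounded below, hence
elements of B near y that stay bounded, and so B y would be nonempty.

(2) Hence the Fitzpatrick functions of A and B, added, lie above their linearisation at (z, z'), and the
Hahn-Banach theorem splits z' as a + b with a in A z and b in B z by maximality.
*)
theory Submission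
  imports Defs
begin

text \<open>Two difficulties shape the argument. Type (FPV) yields points of \<open>gra A\<close>
  over a prescribed open convex set, but such a point says something about A + B only if B has a
  value there, and no interior point of dom A is given that would force this. Moreover dom B need
  not be convex. Its role is taken by \<open>fitz_dom B\<close>, a projection of the domain of the
  Fitzpatrick function: it is convex, contains dom B, and its interior lies in dom B; the boundary
  in question is that of this interior. The drop is used because each of its points y lies between z
  and a point w of the ball where B is bounded. The vectors y - w and z - y then have the same
  direction, so that comparing with a value of B at w controls b (z - y). All existence claims,
  whether of an element of \<open>B y\<close> or of the splitting of z', come from one form of the
  Hahn-Banach theorem: a convex set in X \<times> R that is nonnegative over 0 and bounded above
  near 0 has a continuous linear minorant. Completeness enters through the Baire argument that makes
  B locally bounded.\<close>

subsection \<open>The Hahn-Banach theorem\<close>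

definition sublinear :: "('a::real_vector \<Rightarrow> real) \<Rightarrow> bool" where
  "sublinear p \<longleftrightarrow> (\<forall>x y. p (x + y) \<le> p x + p y) \<and> (\<forall>t>0. \<forall>x. p (t *\<^sub>R x) = t * p x)"

lemma sublinear_add: "sublinear p \<Longrightarrow> p (x + y) \<le> p x + p y"
  and sublinear_scale: "sublinear p \<Longrightarrow> t > 0 \<Longrightarrow> p (t *\<^sub>R x) = t * p x"
  by (auto simp: sublinear_def)

lemma sublinear_zero: "sublinear p \<Longrightarrow> p 0 = 0"
  using sublinear_scale[of p 2 0] by simp

lemma sublinear_minus_le: "sublinear p \<Longrightarrow> - p (- x) \<le> p x"
  using sublinear_add[of p x "- x"] sublinear_zero[of p] by simp

text \<open>The expression under the infimum is nonincreasing in t and stays above -q (-x), so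
  \<open>d y\<close> is its limit as t grows. If q is minimal among sublinear functionals, then
  \<open>d y\<close> = q, and the last inequality becomes superadditivity of q.\<close>

lemma sublinear_directional:
  fixes q :: "'a::real_vector \<Rightarrow> real"
  assumes q: "sublinear q"
  defines "d \<equiv> \<lambda>y x. INF t\<in>{0..}. q (x + t *\<^sub>R y) - t * q y"
  shows "sublinear (d y)" and "d y x \<le> q x" and "d y x \<le> q (x + y) - q y"
proof -
  have lower: "- q (- x) \<le> q (x + t *\<^sub>R y) - t * q y" if "t \<ge> 0" for t x
  proof -
    have "q (t *\<^sub>R y) = t * q y"
      using that sublinear_scale[OF q] sublinear_zero[OF q] by (cases "t = 0") auto
    moreover have "q (t *\<^sub>R y) \<le> q (x + t *\<^sub>R y) + q (- x)"
      using sublinear_add[OF q, of "x + t *\<^sub>R y" "- x"] by simp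
    ultimately show ?thesis by linarith
  qed
  have bdd: "bdd_below ((\<lambda>t. q (x + t *\<^sub>R y) - t * q y) ` {0..})" for x
    using lower by (intro bdd_belowI2[where m = "- q (- x)"]) auto
  have le: "d y x \<le> q (x + t *\<^sub>R y) - t * q y" if "t \<ge> 0" for t x
    unfolding d_def using that by (intro cINF_lower bdd) auto
  show "d y x \<le> q x" using le[of 0 x] by simp
  show "d y x \<le> q (x + y) - q y" using le[of 1 x] by simp
  have ge: "m \<le> d y x" if "\<And>t. t \<ge> 0 \<Longrightarrow> m \<le> q (x + t *\<^sub>R y) - t * q y" for m x
    unfolding d_def using that by (intro cINF_greatest) auto
  show "sublinear (d y)"
    unfolding sublinear_def
  proof (intro conjI allI impI)
    fix x1 x2
    have "d y (x1 + x2) - (q (x2 + s *\<^sub>R y) - s * q y) \<le> d y x1" if s: "s \<ge> 0" for s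
    proof (rule ge)
      fix t :: real assume t: "t \<ge> 0"
      have "q (x1 + x2 + (t + s) *\<^sub>R y) \<le> q (x1 + t *\<^sub>R y) + q (x2 + s *\<^sub>R y)"
        using sublinear_add[OF q, of "x1 + t *\<^sub>R y" "x2 + s *\<^sub>R y"]
        by (simp add: algebra_simps)
      then show "d y (x1 + x2) - (q (x2 + s *\<^sub>R y) - s * q y) \<le> q (x1 + t *\<^sub>R y) - t * q y"
        using le[of "t + s" "x1 + x2"] s t by (simp add: algebra_simps)
    qed
    then have "d y (x1 + x2) - d y x1 \<le> d y x2"
      by (intro ge) (smt (verit))
    then show "d y (x1 + x2) \<le> d y x1 + d y x2" by linarith
  next
    fix t :: real and x assume t: "t > 0"
    have key: "d y (t *\<^sub>R x) \<le> t * d y x" if t: "t > 0" for t x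
    proof -
      have "d y (t *\<^sub>R x) / t \<le> d y x"
      proof (rule ge)
        fix s :: real assume s: "s \<ge> 0"
        have "d y (t *\<^sub>R x) \<le> q (t *\<^sub>R (x + s *\<^sub>R y)) - (t * s) * q y"
          using le[of "t * s" "t *\<^sub>R x"] s t by (simp add: scaleR_add_right)
        also have "\<dots> = t * (q (x + s *\<^sub>R y) - s * q y)"
          using sublinear_scale[OF q t, of "x + s *\<^sub>R y"] by (simp add: algebra_simps)
        finally show "d y (t *\<^sub>R x) / t \<le> q (x + s *\<^sub>R y) - s * q y"
          using t by (simp add: field_simps)
      qed
      then show ?thesis using t by (simp add: field_simps)
    qed
    have "d y ((1/t) *\<^sub>R (t *\<^sub>R x)) \<le> (1/t) * d y (t *\<^sub>R x)"
      using t by (intro key) auto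
    then have "t * d y x \<le> d y (t *\<^sub>R x)" using t by (simp add: field_simps)
    with key[OF t, of x] show "d y (t *\<^sub>R x) = t * d y x" by linarith
  qed
qed

text \<open>A pointwise infimum of sublinear functionals need not be subadditive. In a chain, the
  smaller of two members can serve for both summands. The common upper bound p also gives the lower
  bound -p (-x), which keeps the infimum finite.\<close>

lemma sublinear_chain_Inf:
  fixes C :: "('a::real_vector \<Rightarrow> real) set"
  assumes "C \<noteq> {}" and sub: "\<And>q. q \<in> C \<Longrightarrow> sublinear q"
    and bound: "\<And>q x. q \<in> C \<Longrightarrow> q x \<le> p x"
    and chain: "\<And>q r. q \<in> C \<Longrightarrow> r \<in> C \<Longrightarrow> q \<le> r \<or> r \<le> q"
  shows "sublinear (\<lambda>x. INF q\<in>C. q x)" and "q \<in> C \<Longrightarrow> (INF q\<in>C. q x) \<le> q x"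
proof -
  have bdd: "bdd_below ((\<lambda>q. q x) ` C)" for x
  proof (rule bdd_belowI2[where m = "- p (- x)"])
    fix q assume "q \<in> C"
    then show "- p (- x) \<le> q x"
      using sublinear_minus_le[OF sub, of q x] bound[of q "- x"] by linarith
  qed
  have le: "(INF q\<in>C. q x) \<le> q x" if "q \<in> C" for q x
    using that by (intro cINF_lower bdd)
  then show "q \<in> C \<Longrightarrow> (INF q\<in>C. q x) \<le> q x" by blast
  have ge: "m \<le> (INF q\<in>C. q x)" if "\<And>q. q \<in> C \<Longrightarrow> m \<le> q x" for m x
    using that \<open>C \<noteq> {}\<close> by (intro cINF_greatest)
  show "sublinear (\<lambda>x. INF q\<in>C. q x)"
    unfolding sublinear_def
  proof (intro conjI allI impI)
    fix x y
    have "(INF q\<in>C. q (x + y)) - r y \<le> (INF q\<in>C. q x)" if r: "r \<in> C" for r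
    proof (rule ge)
      fix q assume q: "q \<in> C"
      from chain[OF q r] show "(INF q\<in>C. q (x + y)) - r y \<le> q x"
      proof
        assume "q \<le> r"
        then show ?thesis
          using le[OF q, of "x + y"] sublinear_add[OF sub[OF q], of x y]
          by (smt (verit) le_fun_def)
      next
        assume "r \<le> q"
        then show ?thesis
          using le[OF r, of "x + y"] sublinear_add[OF sub[OF r], of x y]
          by (smt (verit) le_fun_def)
      qed
    qed
    then have "(INF q\<in>C. q (x + y)) - (INF q\<in>C. q x) \<le> (INF q\<in>C. q y)"
      by (intro ge) (smt (verit))
    then show "(INF q\<in>C. q (x + y)) \<le> (INF q\<in>C. q x) + (INF q\<in>C. q y)" by linarith
  next
    fix t :: real and x assume t: "t > 0"
    have "(INF q\<in>C. q (t *\<^sub>R x)) / t \<le> (INF q\<in>C. q x)"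
      using le[of _ "t *\<^sub>R x"] sublinear_scale[OF sub t] t
      by (intro ge) (auto simp: field_simps)
    moreover have "t * (INF q\<in>C. q x) \<le> (INF q\<in>C. q (t *\<^sub>R x))"
    proof (rule ge)
      fix q assume q: "q \<in> C"
      show "t * (INF q\<in>C. q x) \<le> q (t *\<^sub>R x)"
        using le[OF q, of x] sublinear_scale[OF sub[OF q] t, of x] t by (simp add: mult_left_mono)
    qed
    ultimately show "(INF q\<in>C. q (t *\<^sub>R x)) = t * (INF q\<in>C. q x)"
      using t by (simp add: field_simps)
  qed
qed

text \<open>Instead of extending functionals from subspaces, one takes a minimal sublinear functional
  below \<open>p\<close>; comparing it with its directional functionals shows that it is additive.\<close>

theorem Hahn_Banach_sublinear:
  fixes p :: "'a::real_vector \<Rightarrow> real"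
  assumes p: "sublinear p"
  obtains f where "linear f" and "\<And>x. f x \<le> p x"
proof -
  define S where "S = {q. sublinear q \<and> q \<le> p}"
  have "\<exists>m\<in>S. \<forall>q\<in>S. m \<ge> q \<longrightarrow> q = m"
  proof (rule predicate_Zorn)
    show "partial_order_on S (relation_of (\<lambda>x y. x \<ge> y) S)"
      by (rule partial_order_on_relation_ofI) auto
  next
    fix C assume "C \<in> Chains (relation_of (\<lambda>x y. x \<ge> y) S)"
    then have CS: "C \<subseteq> S" and chain: "\<And>q r. q \<in> C \<Longrightarrow> r \<in> C \<Longrightarrow> q \<le> r \<or> r \<le> q"
      by (auto simp: Chains_def relation_of_def)
    show "\<exists>u\<in>S. \<forall>a\<in>C. a \<ge> u"
    proof (cases "C = {}")
      case True
      then show ?thesis using p by (auto simp: S_def)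
    next
      case False
      have C: "\<And>q. q \<in> C \<Longrightarrow> sublinear q" "\<And>q x. q \<in> C \<Longrightarrow> q x \<le> p x"
        using CS by (auto simp: S_def le_fun_def)
      note inf = sublinear_chain_Inf[where C = C and p = p, OF False _ _ chain]
      define u where "u = (\<lambda>x. INF q\<in>C. q x)"
      have below: "u \<le> q" if "q \<in> C" for q
        unfolding le_fun_def u_def by (intro allI inf(2) C that)
      moreover obtain q where "q \<in> C" using False by blast
      moreover have "sublinear u" unfolding u_def by (intro inf(1) C)
      ultimately have "u \<in> S" using CS by (auto simp: S_def intro: order_trans)
      with below show ?thesis by blast
    qed
  qed
  then obtain m where m: "sublinear m" "m \<le> p"
    and min: "\<And>q. sublinear q \<Longrightarrow> q \<le> m \<Longrightarrow> q = m"
    by (smt (verit) S_def mem_Collect_eq order_trans)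
  have add: "m (x + y) = m x + m y" for x y
  proof -
    have "(\<lambda>x. INF t\<in>{0..}. m (x + t *\<^sub>R y) - t * m y) = m"
      by (intro min le_funI sublinear_directional m(1))
    from fun_cong[OF this, of x] have "m x \<le> m (x + y) - m y"
      using sublinear_directional(3)[OF m(1), of x y] by linarith
    then show ?thesis using sublinear_add[OF m(1), of x y] by linarith
  qed
  have neg: "m (- x) = - m x" for x
    using add[of x "- x"] sublinear_zero[OF m(1)] by simp
  have "linear m"
  proof (rule linearI)
    fix t :: real and x
    consider "t > 0" | "t = 0" | "t < 0" by linarith
    then show "m (t *\<^sub>R x) = t *\<^sub>R m x"
    proof cases
      case 3
      then have "m ((- t) *\<^sub>R x) = - t * m x" by (intro sublinear_scale[OF m(1)]) auto
      then show ?thesis using neg[of "t *\<^sub>R x"] by simp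
    qed (use sublinear_scale[OF m(1)] sublinear_zero[OF m(1)] in auto)
  qed (rule add)
  then show ?thesis using m(2) that by (auto simp: le_fun_def)
qed

text \<open>Think of K as part of the epigraph of a convex function that is nonnegative at 0. The
  functional p is the lower boundary of the cone generated by K; it is finite because the cone stays
  nonnegative over 0. The upper bound M near 0 gives p linear growth, hence continuity of every
  linear functional below it.\<close>

theorem Hahn_Banach_epigraph:
  fixes K :: "('a::real_normed_vector \<times> real) set"
  assumes K: "convex K"
    and zero: "\<And>r. (0, r) \<in> K \<Longrightarrow> 0 \<le> r"
    and \<rho>: "\<rho> > 0" and near: "\<And>v. norm v < \<rho> \<Longrightarrow> \<exists>r\<le>M. (v, r) \<in> K"
  obtains f :: "'a \<Rightarrow>\<^sub>L real" where "\<And>v r. (v, r) \<in> K \<Longrightarrow> blinfun_apply f v \<le> r"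
proof -
  define S where "S = (\<lambda>v. {t * r | t w r. t > 0 \<and> (w, r) \<in> K \<and> v = t *\<^sub>R w})"
  define p where "p = (\<lambda>v. Inf (S v))"
  have SI: "t * r \<in> S (t *\<^sub>R w)" if "t > 0" "(w, r) \<in> K" for t w r
    using that by (auto simp: S_def)
  have S_add: "a + b \<in> S (v + w)" if a: "a \<in> S v" and b: "b \<in> S w" for a b v w
  proof -
    obtain t x r where 1: "a = t * r" "t > 0" "(x, r) \<in> K" "v = t *\<^sub>R x"
      using a by (auto simp: S_def)
    obtain s y q where 2: "b = s * q" "s > 0" "(y, q) \<in> K" "w = s *\<^sub>R y"
      using b by (auto simp: S_def)
    have "(t / (t + s)) *\<^sub>R (x, r) + (s / (t + s)) *\<^sub>R (y, q) \<in> K"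
      using 1 2 by (intro convexD[OF K]) (auto simp: add_divide_distrib[symmetric])
    then have "(t + s) * (t / (t + s) * r + s / (t + s) * q) \<in>
        S ((t + s) *\<^sub>R ((t / (t + s)) *\<^sub>R x + (s / (t + s)) *\<^sub>R y))"
      using 1 2 by (intro SI) auto
    moreover have "(t + s) * (t / (t + s) * r + s / (t + s) * q) = a + b"
      using 1 2 by (simp add: distrib_left)
    moreover have "(t + s) *\<^sub>R ((t / (t + s)) *\<^sub>R x + (s / (t + s)) *\<^sub>R y) = v + w"
      using 1 2 by (simp add: scaleR_add_right)
    ultimately show ?thesis by simp
  qed
  have S_scale: "t * a \<in> S (t *\<^sub>R v)" if t: "t > 0" and a: "a \<in> S v" for t a v
  proof -
    obtain s w r where "a = s * r" "s > 0" "(w, r) \<in> K" "v = s *\<^sub>R w"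
      using a unfolding S_def by blast
    then show ?thesis using SI[of "t * s" w r] t by (simp add: mult.assoc)
  qed
  have S_zero: "0 \<le> a" if "a \<in> S 0" for a
    using that zero by (auto simp: S_def)
  have S_bound: "\<exists>a\<in>S v. a \<le> 2 * \<bar>M\<bar> / \<rho> * norm v" if "v \<noteq> 0" for v
  proof -
    let ?t = "2 * norm v / \<rho>"
    have t: "?t > 0" using that \<rho> by simp
    have "norm ((1 / ?t) *\<^sub>R v) < \<rho>" using that \<rho> by simp
    then obtain r where r: "r \<le> M" "((1 / ?t) *\<^sub>R v, r) \<in> K" using near by blast
    have "?t * r \<in> S (?t *\<^sub>R ((1 / ?t) *\<^sub>R v))" by (rule SI[OF t r(2)])
    then have "?t * r \<in> S v" using that \<rho> by simp
    moreover have "?t * r \<le> ?t * \<bar>M\<bar>" using r t by (intro mult_left_mono) auto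
    ultimately show ?thesis by (intro bexI[of _ "?t * r"]) (auto simp: field_simps)
  qed
  have S_nonempty: "S v \<noteq> {}" for v
  proof (cases "v = 0")
    case True
    obtain r where "(0, r) \<in> K" using near[of 0] \<rho> by auto
    then show ?thesis using SI[of 1 0 r] True by auto
  qed (use S_bound in blast)
  have S_bdd: "bdd_below (S v)" for v
  proof -
    obtain b where b: "b \<in> S (- v)" using S_nonempty by blast
    have "- b \<le> a" if "a \<in> S v" for a
      using S_zero[of "a + b"] S_add[OF that b] by simp
    then show ?thesis by (rule bdd_belowI)
  qed
  have p_le: "p v \<le> a" if "a \<in> S v" for a v
    unfolding p_def using that S_bdd by (intro cInf_lower)
  have p_ge: "m \<le> p v" if "\<And>a. a \<in> S v \<Longrightarrow> m \<le> a" for m v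
    unfolding p_def using that S_nonempty by (intro cInf_greatest)
  have "sublinear p"
    unfolding sublinear_def
  proof (intro conjI allI impI)
    fix v w
    have "p (v + w) - b \<le> p v" if "b \<in> S w" for b
      using p_le[OF S_add[OF _ that]] by (intro p_ge) (smt (verit))
    then have "p (v + w) - p v \<le> p w" by (intro p_ge) (smt (verit))
    then show "p (v + w) \<le> p v + p w" by linarith
  next
    fix t :: real and v :: 'a assume t: "t > 0"
    have "p (t *\<^sub>R v) / t \<le> p v"
      using p_le[OF S_scale[OF t]] t by (intro p_ge) (simp add: field_simps)
    moreover have "t * p v \<le> p (t *\<^sub>R v)"
    proof (rule p_ge)
      fix a assume "a \<in> S (t *\<^sub>R v)"
      then have "(1/t) * a \<in> S ((1/t) *\<^sub>R (t *\<^sub>R v))" using t by (intro S_scale) auto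
      then have "p v \<le> (1/t) * a" using t by (intro p_le) simp
      then show "t * p v \<le> a" using t by (simp add: field_simps)
    qed
    ultimately show "p (t *\<^sub>R v) = t * p v" using t by (simp add: field_simps)
  qed
  then obtain f where f: "linear f" and fp: "\<And>v. f v \<le> p v"
    using Hahn_Banach_sublinear by blast
  have f_le: "f v \<le> 2 * \<bar>M\<bar> / \<rho> * norm v" for v
  proof (cases "v = 0")
    case False
    then obtain a where "a \<in> S v" "a \<le> 2 * \<bar>M\<bar> / \<rho> * norm v" using S_bound by blast
    then show ?thesis using fp[of v] p_le[of a v] by linarith
  qed (use linear_0[OF f] in simp)
  have "bounded_linear f"
  proof (rule bounded_linear_intro)
    show "norm (f v) \<le> norm v * (2 * \<bar>M\<bar> / \<rho>)" for v
      using f_le[of v] f_le[of "- v"] by (simp add: linear_neg[OF f] abs_le_iff mult.commute)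
  qed (use f in \<open>auto simp: linear_add linear_scale\<close>)
  then have "blinfun_apply (Blinfun f) = f" by (rule bounded_linear_Blinfun_apply)
  moreover have "f v \<le> r" if "(v, r) \<in> K" for v r
    using fp[of v] p_le[of r v] SI[OF _ that, of 1] by simp
  ultimately show ?thesis using that by metis
qed

section \<open>Norming functionals, separating functionals and norm estimates\<close>

lemma small_factor:
  fixes c p :: real
  assumes "c > 0"
  obtains t where "0 < t" "t \<le> 1 / 2" "t * p < c"
proof (cases "p > 0")
  case True
  let ?t = "min (1 / 2) (c / (2 * p))"
  have "?t * p \<le> c / (2 * p) * p" using True by (intro mult_right_mono) auto
  then have "?t * p < c" using True assms by simp
  then show ?thesis using that[of ?t] True assms by simp
next
  case False
  then have "1 / 2 * p < c" using assms by simp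
  then show ?thesis using that[of "1 / 2"] by simp
qed

text \<open>The set is the epigraph of the norm enlarged by the line through (x, norm x). A linear
  minorant lies below the norm, and the line forces it to take the value norm x at x.\<close>

lemma norming_functional:
  fixes x :: "'a::real_normed_vector"
  obtains f :: "'a \<Rightarrow>\<^sub>L real" where "blinfun_apply f x = norm x" and "\<And>v. blinfun_apply f v \<le> norm v"
proof -
  let ?K = "{(v - t *\<^sub>R x, s - t * norm x) | v t s. norm v \<le> s}"
  have KI: "(v - t *\<^sub>R x, s - t * norm x) \<in> ?K" if "norm v \<le> s" for v t s
    using that by blast
  have "convex ?K"
  proof (rule convexI, clarify)
    fix u w :: real and v1 v2 :: 'a and t1 t2 s1 s2 :: real
    assume *: "0 \<le> u" "0 \<le> w" "norm v1 \<le> s1" "norm v2 \<le> s2"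
    have "norm (u *\<^sub>R v1 + w *\<^sub>R v2) \<le> u * s1 + w * s2"
      using * by (intro norm_triangle_le) (simp add: add_mono mult_left_mono)
    then show "\<exists>v t s. u *\<^sub>R (v1 - t1 *\<^sub>R x, s1 - t1 * norm x) + w *\<^sub>R (v2 - t2 *\<^sub>R x, s2 - t2 * norm x)
        = (v - t *\<^sub>R x, s - t * norm x) \<and> norm v \<le> s"
      by (intro exI[of _ "u *\<^sub>R v1 + w *\<^sub>R v2"] exI[of _ "u * t1 + w * t2"] exI[of _ "u * s1 + w * s2"])
        (simp add: algebra_simps)
  qed
  moreover have "0 \<le> r" if r: "(0, r) \<in> ?K" for r
  proof -
    obtain v t s where *: "v = t *\<^sub>R x" "r = s - t * norm x" "norm v \<le> s" using r by force
    have "t * norm x \<le> norm v" unfolding *(1) by (simp add: mult_right_mono)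
    then show ?thesis using * by linarith
  qed
  moreover have "\<exists>r\<le>1. (v, r) \<in> ?K" if "norm v < 1" for v
    using KI[of v 1 0] that by (intro exI[of _ 1] conjI) auto
  ultimately obtain f :: "'a \<Rightarrow>\<^sub>L real" where f: "\<And>v r. (v, r) \<in> ?K \<Longrightarrow> blinfun_apply f v \<le> r"
    using Hahn_Banach_epigraph[of ?K 1 1] zero_less_one by blast
  have le: "blinfun_apply f v \<le> norm v" for v
    using f[OF KI[of v "norm v" 0]] by simp
  have "blinfun_apply f (- x) \<le> - norm x"
    using f[OF KI[of 0 0 1]] by simp
  then have "blinfun_apply f x = norm x"
    using le[of x] by (simp add: blinfun.minus_right)
  with le that show ?thesis by blast
qed

text \<open>A minorant f of this set satisfies f d - t * f y <= 1 - t for all d in D and t >= 0.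
  Taking t = 0 bounds f on D, and letting t grow gives f y >= 1. The set is nonnegative over 0
  because t y in D with t > 1 would, together with the ball, put y in the interior of D.\<close>

lemma separating_functional:
  fixes D :: "'a::real_normed_vector set"
  assumes D: "convex D" and \<rho>: "\<rho> > 0" "ball 0 \<rho> \<subseteq> D" and y: "y \<notin> interior D"
  obtains f :: "'a \<Rightarrow>\<^sub>L real" where "1 \<le> blinfun_apply f y" and "\<And>d. d \<in> D \<Longrightarrow> blinfun_apply f d \<le> 1"
proof -
  let ?K = "{(d - t *\<^sub>R y, 1 - t) | d t. d \<in> D \<and> t \<ge> 0}"
  have KI: "(d - t *\<^sub>R y, 1 - t) \<in> ?K" if "d \<in> D" "t \<ge> 0" for d t
    using that by blast
  have "convex ?K"
  proof (rule convexI, clarify)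
    fix u w :: real and d1 d2 :: 'a and t1 t2 :: real
    assume *: "0 \<le> u" "0 \<le> w" "u + w = 1" "d1 \<in> D" "d2 \<in> D" "0 \<le> t1" "0 \<le> t2"
    have "u *\<^sub>R d1 + w *\<^sub>R d2 \<in> D" using * by (intro convexD[OF D])
    with * show "\<exists>d t. u *\<^sub>R (d1 - t1 *\<^sub>R y, 1 - t1) + w *\<^sub>R (d2 - t2 *\<^sub>R y, 1 - t2)
        = (d - t *\<^sub>R y, 1 - t) \<and> d \<in> D \<and> t \<ge> 0"
      by (intro exI[of _ "u *\<^sub>R d1 + w *\<^sub>R d2"] exI[of _ "u * t1 + w * t2"])
        (simp add: algebra_simps)
  qed
  moreover have "0 \<le> r" if r: "(0, r) \<in> ?K" for r
  proof (rule ccontr)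
    assume "\<not> 0 \<le> r"
    then obtain t where t: "t *\<^sub>R y \<in> D" "t > 1" using r by auto
    have "ball y ((1 - 1/t) * \<rho>) \<subseteq> D"
    proof
      fix v assume v: "v \<in> ball y ((1 - 1/t) * \<rho>)"
      define w where "w = (1 / (1 - 1/t)) *\<^sub>R (v - y)"
      have pos: "1 - 1/t > 0" using t by simp
      have "norm w < \<rho>"
        using v pos by (simp add: w_def dist_norm norm_minus_commute pos_divide_less_eq mult.commute)
      then have "w \<in> D" using \<rho> by auto
      then have "(1/t) *\<^sub>R (t *\<^sub>R y) + (1 - 1/t) *\<^sub>R w \<in> D"
        using t pos by (intro convexD[OF D]) auto
      moreover have "(1/t) *\<^sub>R (t *\<^sub>R y) + (1 - 1/t) *\<^sub>R w = v"
        using t pos by (simp add: w_def)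
      ultimately show "v \<in> D" by simp
    qed
    moreover have "(1 - 1/t) * \<rho> > 0" using t \<rho> by simp
    ultimately have "y \<in> interior D" by (auto simp: mem_interior)
    with y show False ..
  qed
  moreover have "\<exists>r\<le>1. (v, r) \<in> ?K" if "norm v < \<rho>" for v
    using KI[of v 0] that \<rho> by (intro exI[of _ 1] conjI) auto
  ultimately obtain f :: "'a \<Rightarrow>\<^sub>L real" where f: "\<And>v r. (v, r) \<in> ?K \<Longrightarrow> blinfun_apply f v \<le> r"
    using Hahn_Banach_epigraph[of ?K \<rho> 1] \<rho>(1) by blast
  have le: "blinfun_apply f d \<le> 1" if "d \<in> D" for d
    using f[OF KI[of d 0]] that by simp
  have "0 \<in> D" using \<rho> by auto
  have neg: "- (t * blinfun_apply f y) \<le> 1 - t" if "t \<ge> 0" for t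
    using f[OF KI[of 0 t]] that \<open>0 \<in> D\<close>
    by (simp add: blinfun.minus_right blinfun.scaleR_right)
  have "1 \<le> blinfun_apply f y"
  proof (rule ccontr)
    assume "\<not> ?thesis"
    then have pos: "1 - blinfun_apply f y > 0" by simp
    define t where "t = 2 / (1 - blinfun_apply f y)"
    have "t * (1 - blinfun_apply f y) = 2" using pos unfolding t_def by (metis less_irrefl nonzero_divide_eq_eq)
    moreover have "t \<ge> 0" using pos by (simp add: t_def)
    ultimately show False using neg[of t] by (simp add: right_diff_distrib)
  qed
  with le that show ?thesis by blast
qed

lemma blinfun_norm_bound_ball:
  fixes f :: "'a::real_normed_vector \<Rightarrow>\<^sub>L real"
  assumes "\<sigma> > 0" and le: "\<And>u. norm u \<le> \<sigma> \<Longrightarrow> blinfun_apply f u \<le> c"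
  shows "\<sigma> * norm f \<le> c"
proof -
  have c: "0 \<le> c" using le[of 0] \<open>\<sigma> > 0\<close> by simp
  have "norm f \<le> c / \<sigma>"
  proof (rule norm_blinfun_bound)
    fix x
    show "norm (blinfun_apply f x) \<le> c / \<sigma> * norm x"
    proof (cases "x = 0")
      case False
      let ?u = "(\<sigma> / norm x) *\<^sub>R x"
      have n: "norm ?u = \<sigma>" "norm (- ?u) = \<sigma>" using False \<open>\<sigma> > 0\<close> by auto
      have "blinfun_apply f ?u \<le> c" "blinfun_apply f (- ?u) \<le> c"
        by (intro le; use n in linarith)+
      then have "\<bar>\<sigma> / norm x * blinfun_apply f x\<bar> \<le> c"
        by (simp add: blinfun.minus_right blinfun.scaleR_right abs_le_iff)
      then show ?thesis using False \<open>\<sigma> > 0\<close> by (simp add: abs_mult field_simps)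
    qed simp
  qed (use c \<open>\<sigma> > 0\<close> in auto)
  then show ?thesis using \<open>\<sigma> > 0\<close> by (simp add: field_simps)
qed

subsection \<open>Maximally monotone operators and Fitzpatrick functions\<close>

lemma maximally_monotone_iff:
  "maximally_monotone A \<longleftrightarrow>
    (\<forall>x y. \<forall>a\<in>A x. \<forall>b\<in>A y. 0 \<le> blinfun_apply (a - b) (x - y)) \<and>
    (\<forall>x a. (\<forall>y. \<forall>b\<in>A y. 0 \<le> blinfun_apply (a - b) (x - y)) \<longrightarrow> a \<in> A x)"
    (is "_ \<longleftrightarrow> ?mono A \<and> ?max")
proof -
  have mono: "monotone_op B \<longleftrightarrow> ?mono B" for B :: "'a set_op"
    by (auto simp: monotone_op_def gra_def)
  have "?max \<longleftrightarrow> \<not> (\<exists>B. monotone_op B \<and> gra A \<subset> gra B)" if A: "?mono A"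
  proof
    assume max: ?max
    show "\<not> (\<exists>B. monotone_op B \<and> gra A \<subset> gra B)"
    proof (intro notI, elim exE conjE)
      fix B assume B: "monotone_op B" and "gra A \<subset> gra B"
      then obtain x a where xa: "a \<in> B x" "a \<notin> A x" and sub: "\<And>y. A y \<subseteq> B y"
        by (auto simp: gra_def psubset_eq)
      have "a \<in> A x" using B[unfolded mono] xa(1) sub by (intro max[rule_format]) blast
      with xa show False by blast
    qed
  next
    assume R: "\<not> (\<exists>B. monotone_op B \<and> gra A \<subset> gra B)"
    show ?max
    proof (intro allI impI, rule ccontr)
      fix x a assume rel: "\<forall>y. \<forall>b\<in>A y. 0 \<le> blinfun_apply (a - b) (x - y)" and "a \<notin> A x"
      let ?B = "A(x := insert a (A x))"
      have sym: "0 \<le> blinfun_apply (b - a) (y - x)" if "b \<in> A y" for y b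
        using rel that by (metis (no_types, lifting) blinfun.minus_left blinfun.minus_right minus_diff_eq minus_minus)
      have "?mono ?B"
        using A rel sym by (auto split: if_splits)
      then have "monotone_op ?B" by (simp add: mono)
      moreover have "gra A \<subset> gra ?B"
        using \<open>a \<notin> A x\<close> by (auto simp: gra_def split: if_splits)
      ultimately show False using R by blast
    qed
  qed
  then show ?thesis unfolding maximally_monotone_def mono by blast
qed

lemma maximally_monotoneD:
  assumes "maximally_monotone A"
  shows "a \<in> A x \<Longrightarrow> b \<in> A y \<Longrightarrow> 0 \<le> blinfun_apply (a - b) (x - y)"
    and "(\<And>y b. b \<in> A y \<Longrightarrow> 0 \<le> blinfun_apply (a - b) (x - y)) \<Longrightarrow> a \<in> A x"
  using assms unfolding maximally_monotone_iff by blast+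

text \<open>\<open>fitz_le B x u r\<close> says that the Fitzpatrick function of \<open>B\<close> is at most \<open>r\<close> at \<open>(x, u)\<close>.\<close>

definition fitz_le :: "'a::real_normed_vector set_op \<Rightarrow> 'a \<Rightarrow> ('a \<Rightarrow>\<^sub>L real) \<Rightarrow> real \<Rightarrow> bool" where
  "fitz_le B x u r \<longleftrightarrow> (\<forall>y. \<forall>b\<in>B y. blinfun_apply b x + blinfun_apply u y - blinfun_apply b y \<le> r)"

text \<open>The convex substitute for \<open>op_dom B\<close>, obtained by projecting the domain of
  the Fitzpatrick function to the first factor.\<close>

definition fitz_dom :: "'a::real_normed_vector set_op \<Rightarrow> 'a set" where
  "fitz_dom B = {x. \<exists>u r. fitz_le B x u r}"

lemma fitz_leD: "fitz_le B x u r \<Longrightarrow> b \<in> B y \<Longrightarrow>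
    blinfun_apply b x + blinfun_apply u y - blinfun_apply b y \<le> r"
  by (simp add: fitz_le_def)

lemma fitz_le_convex:
  assumes "fitz_le B x u r" "fitz_le B y v s" "0 \<le> \<alpha>" "0 \<le> \<beta>" "\<alpha> + \<beta> = 1"
  shows "fitz_le B (\<alpha> *\<^sub>R x + \<beta> *\<^sub>R y) (\<alpha> *\<^sub>R u + \<beta> *\<^sub>R v) (\<alpha> * r + \<beta> * s)"
  unfolding fitz_le_def
proof (intro allI ballI)
  fix w b assume b: "b \<in> B w"
  have "\<alpha> * (blinfun_apply b x + blinfun_apply u w - blinfun_apply b w)
      + \<beta> * (blinfun_apply b y + blinfun_apply v w - blinfun_apply b w) \<le> \<alpha> * r + \<beta> * s"
    using assms b by (intro add_mono mult_left_mono fitz_leD[of B])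
  moreover have "blinfun_apply b w = \<alpha> * blinfun_apply b w + \<beta> * blinfun_apply b w"
    using assms by (metis distrib_right mult_1)
  ultimately show "blinfun_apply b (\<alpha> *\<^sub>R x + \<beta> *\<^sub>R y) + blinfun_apply (\<alpha> *\<^sub>R u + \<beta> *\<^sub>R v) w
      - blinfun_apply b w \<le> \<alpha> * r + \<beta> * s"
    by (simp add: blinfun.add_left blinfun.add_right blinfun.scaleR_left blinfun.scaleR_right
        algebra_simps)
qed

lemma convex_fitz_dom: "convex (fitz_dom B)"
  unfolding fitz_dom_def by (rule convexI) (blast intro: fitz_le_convex)

lemma fitz_le_graph:
  assumes "maximally_monotone B" "b \<in> B x"
  shows "fitz_le B x b (blinfun_apply b x)"
  unfolding fitz_le_def
  using maximally_monotoneD(1)[OF assms] by (force simp: blinfun.diff_left blinfun.diff_right)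

lemma fitz_dom_graph: "maximally_monotone B \<Longrightarrow> b \<in> B x \<Longrightarrow> x \<in> fitz_dom B"
  unfolding fitz_dom_def using fitz_le_graph by blast

text \<open>If r were smaller than u x, then (x, u) would be monotonically related to the graph and
  so belong to it; but testing the bound at (x, u) itself gives u x <= r.\<close>

lemma fitz_le_ge:
  assumes B: "maximally_monotone B" and le: "fitz_le B x u r"
  shows "blinfun_apply u x \<le> r"
proof (rule ccontr)
  assume lt: "\<not> ?thesis"
  have "u \<in> B x"
    using fitz_leD[OF le] lt
    by (intro maximally_monotoneD(2)[OF B]) (force simp: blinfun.diff_left blinfun.diff_right)
  from fitz_leD[OF le this] lt show False by simp
qed

text \<open>The epigraph at \<open>x\<close> lies above a linear functional only if that functional belongs to \<open>B x\<close>;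
  this reduces membership in the domain to the Hahn-Banach theorem.\<close>

definition fitz_epi :: "'a::real_normed_vector set_op \<Rightarrow> 'a \<Rightarrow> ('a \<times> real) set" where
  "fitz_epi B x = {(v, r). \<exists>u. fitz_le B (x + v) u (r + blinfun_apply u x)}"

lemma fitz_epiI: "fitz_le B (x + v) u (r + blinfun_apply u x) \<Longrightarrow> (v, r) \<in> fitz_epi B x"
  by (auto simp: fitz_epi_def)

lemma fitz_epiE:
  assumes "(v, r) \<in> fitz_epi B x"
  obtains u where "fitz_le B (x + v) u (r + blinfun_apply u x)"
  using assms by (auto simp: fitz_epi_def)

lemma convex_fitz_epi: "convex (fitz_epi B x)"
proof (rule convexI)
  fix p q and \<alpha> \<beta> :: real
  assume "p \<in> fitz_epi B x" "q \<in> fitz_epi B x" and ab: "0 \<le> \<alpha>" "0 \<le> \<beta>" "\<alpha> + \<beta> = 1"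
  then obtain u v where "fitz_le B (x + fst p) u (snd p + blinfun_apply u x)"
    "fitz_le B (x + fst q) v (snd q + blinfun_apply v x)"
    by (metis fitz_epiE prod.collapse)
  from fitz_le_convex[OF this ab]
  have "fitz_le B (\<alpha> *\<^sub>R (x + fst p) + \<beta> *\<^sub>R (x + fst q)) (\<alpha> *\<^sub>R u + \<beta> *\<^sub>R v)
      ((\<alpha> * snd p + \<beta> * snd q) + blinfun_apply (\<alpha> *\<^sub>R u + \<beta> *\<^sub>R v) x)"
    by (simp add: blinfun.add_left blinfun.scaleR_left algebra_simps)
  moreover have "\<alpha> *\<^sub>R (x + fst p) + \<beta> *\<^sub>R (x + fst q) = x + (\<alpha> *\<^sub>R fst p + \<beta> *\<^sub>R fst q)"
    using ab by (simp add: algebra_simps flip: scaleR_add_left)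
  ultimately have "(\<alpha> *\<^sub>R fst p + \<beta> *\<^sub>R fst q, \<alpha> * snd p + \<beta> * snd q) \<in> fitz_epi B x"
    by (metis fitz_epiI)
  then show "\<alpha> *\<^sub>R p + \<beta> *\<^sub>R q \<in> fitz_epi B x"
    by (simp add: scaleR_prod_def plus_prod_def)
qed

lemma fitz_epi_zero:
  assumes "maximally_monotone B" "(0, r) \<in> fitz_epi B x"
  shows "0 \<le> r"
  using assms fitz_le_ge[OF assms(1)] by (force simp: fitz_epi_def)

lemma fitz_epi_graph:
  assumes "maximally_monotone B" "b \<in> B y"
  shows "(y - x, blinfun_apply b (y - x)) \<in> fitz_epi B x"
  using fitz_le_graph[OF assms] by (intro fitz_epiI[where u = b]) (simp add: blinfun.diff_right)

lemma fitz_epi_minorant: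
  assumes B: "maximally_monotone B" and f: "\<And>v r. (v, r) \<in> fitz_epi B x \<Longrightarrow> blinfun_apply f v \<le> r"
  shows "f \<in> B x"
proof (rule maximally_monotoneD(2)[OF B])
  fix y b assume "b \<in> B y"
  from f[OF fitz_epi_graph[OF B this]] show "0 \<le> blinfun_apply (f - b) (x - y)"
    by (simp add: blinfun.diff_left blinfun.diff_right)
qed

text \<open>Since x is interior, (1 + t) x is still in \<open>fitz_dom B\<close>, and x is a convex
  combination of that point and 0. Combining one Fitzpatrick bound at (1 + t) x with the bounded
  values of B near 0 bounds the epigraph from above on a ball about x, and a linear minorant is then
  an element of \<open>B x\<close>.\<close>

lemma interior_fitz_dom:
  assumes B: "maximally_monotone B" and \<rho>: "\<rho> > 0"
    and bounded: "\<And>v. norm v < \<rho> \<Longrightarrow> \<exists>b\<in>B v. norm b \<le> K"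
    and x: "x \<in> interior (fitz_dom B)"
  shows "B x \<noteq> {}"
proof -
  have K: "K \<ge> 0" using bounded[of 0] \<rho> by (force intro: order_trans[OF norm_ge_zero])
  obtain e where e: "e > 0" "ball x e \<subseteq> fitz_dom B" using x by (auto simp: mem_interior)
  obtain t where t: "0 < t" and "t * norm x < e"
    using small_factor[OF e(1), of "norm x"] by blast
  then have "(1 + t) *\<^sub>R x \<in> fitz_dom B"
    using t by (intro subsetD[OF e(2)]) (simp add: dist_norm scaleR_add_left)
  then obtain u r where u: "fitz_le B ((1 + t) *\<^sub>R x) u r" by (auto simp: fitz_dom_def)
  define \<alpha> \<beta> where "\<alpha> = 1 / (1 + t)" and "\<beta> = t / (1 + t)"
  have ab: "\<alpha> > 0" "\<beta> > 0" "\<alpha> + \<beta> = 1" "\<alpha> * (1 + t) = 1"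
    using t by (auto simp: \<alpha>_def \<beta>_def add_divide_distrib[symmetric])
  define M where "M = \<alpha> * r + \<beta> * (K * \<rho>) - \<alpha> * blinfun_apply u x + \<beta> * (K * norm x)"
  have near: "\<exists>r\<le>M. (v, r) \<in> fitz_epi B x" if v: "norm v < \<beta> * \<rho>" for v
  proof -
    define w where "w = (1 / \<beta>) *\<^sub>R v"
    have w: "norm w < \<rho>" using v ab by (simp add: w_def field_simps)
    then obtain b where b: "b \<in> B w" "norm b \<le> K" using bounded by blast
    from fitz_le_convex[OF u fitz_le_graph[OF B b(1)], of \<alpha> \<beta>] ab
    have "fitz_le B (\<alpha> *\<^sub>R (1 + t) *\<^sub>R x + \<beta> *\<^sub>R w) (\<alpha> *\<^sub>R u + \<beta> *\<^sub>R b) (\<alpha> * r + \<beta> * blinfun_apply b w)"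
      by simp
    moreover have "\<alpha> *\<^sub>R (1 + t) *\<^sub>R x + \<beta> *\<^sub>R w = x + v"
      using ab by (simp add: w_def del: scaleR_add_left)
    ultimately have "(v, \<alpha> * r + \<beta> * blinfun_apply b w - blinfun_apply (\<alpha> *\<^sub>R u + \<beta> *\<^sub>R b) x) \<in> fitz_epi B x"
      by (intro fitz_epiI[where u = "\<alpha> *\<^sub>R u + \<beta> *\<^sub>R b"]) simp
    moreover have "\<alpha> * r + \<beta> * blinfun_apply b w - blinfun_apply (\<alpha> *\<^sub>R u + \<beta> *\<^sub>R b) x \<le> M"
    proof -
      have "blinfun_apply b w \<le> norm b * norm w" using norm_blinfun[of b w] by simp
      also have "\<dots> \<le> K * \<rho>" using b w K by (intro mult_mono) auto
      finally have 1: "\<beta> * blinfun_apply b w \<le> \<beta> * (K * \<rho>)" using ab by simp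
      have "- blinfun_apply b x \<le> norm b * norm x" using norm_blinfun[of b x] by simp
      also have "\<dots> \<le> K * norm x" using b by (intro mult_right_mono) auto
      finally have 2: "\<beta> * (- blinfun_apply b x) \<le> \<beta> * (K * norm x)"
        using ab by (intro mult_left_mono) auto
      show ?thesis
        using 1 2 by (simp add: M_def blinfun.add_left blinfun.scaleR_left)
    qed
    ultimately show ?thesis by blast
  qed
  have "\<beta> * \<rho> > 0" using ab \<rho> by simp
  then obtain f :: "'a \<Rightarrow>\<^sub>L real" where "\<And>v r. (v, r) \<in> fitz_epi B x \<Longrightarrow> blinfun_apply f v \<le> r"
    using Hahn_Banach_epigraph[of "fitz_epi B x" "\<beta> * \<rho>" M] convex_fitz_epi fitz_epi_zero[OF B] near
    by blast
  then have "f \<in> B x" by (rule fitz_epi_minorant[OF B])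
  then show ?thesis by blast
qed

text \<open>A weak* cluster point of the bounded elements would lie in \<open>B y\<close>. Instead
  of compactness, their bound M is used to show that the epigraph at y lies above -M * norm v, which
  leaves room for a linear functional in between.\<close>

lemma domain_closed_if_bounded:
  assumes B: "maximally_monotone B" and "B w \<noteq> {}"
    and approx: "\<And>\<delta>. \<delta> > 0 \<Longrightarrow> \<exists>y'. \<exists>b\<in>B y'. norm (y' - y) < \<delta> \<and> norm b \<le> M"
  shows "B y \<noteq> {}"
proof -
  have M: "M \<ge> 0" using approx[of 1] by (force intro: order_trans[OF norm_ge_zero])
  have lower: "- M * norm v \<le> r" if vr: "(v, r) \<in> fitz_epi B y" for v r
  proof (rule field_le_epsilon)
    fix e :: real assume e: "e > 0"
    obtain u where u: "fitz_le B (y + v) u (r + blinfun_apply u y)"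
      using fitz_epiE[OF vr] by blast
    \<comment> \<open>Moving from y' to y costs at most (M + norm u) * \<delta>, which this choice
      keeps below e; the summand 1 keeps the denominator positive.\<close>
    define \<delta> where "\<delta> = e / (M + norm u + 1)"
    have pos: "M + norm u + 1 > 0" using M by (simp add: add_nonneg_pos)
    then have "\<delta> > 0" using e by (simp add: \<delta>_def)
    then obtain y' b where b: "b \<in> B y'" "norm (y' - y) < \<delta>" "norm b \<le> M" using approx by blast
    have 1: "blinfun_apply b (y - y' + v) + blinfun_apply u (y' - y) \<le> r"
      using fitz_leD[OF u b(1)] by (simp add: blinfun.add_right blinfun.diff_right)
    have "- blinfun_apply b (y - y' + v) \<le> norm b * norm (y - y' + v)"
      using norm_blinfun[of b "y - y' + v"] by simp
    also have "\<dots> \<le> M * (norm (y' - y) + norm v)"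
      using b M norm_triangle_ineq[of "y - y'" v]
      by (intro mult_mono) (auto simp: norm_minus_commute)
    finally have 2: "- blinfun_apply b (y - y' + v) \<le> M * norm (y' - y) + M * norm v"
      by (simp add: algebra_simps)
    have 3: "- blinfun_apply u (y' - y) \<le> norm u * norm (y' - y)"
      using norm_blinfun[of u "y' - y"] by simp
    have "(M + norm u) * norm (y' - y) \<le> (M + norm u + 1) * \<delta>"
      using b M by (intro mult_mono) auto
    also have "\<dots> = e" using pos by (simp add: \<delta>_def)
    finally show "- M * norm v \<le> r + e" using 1 2 3 by (simp add: algebra_simps)
  qed
  \<comment> \<open>The infimal convolution of the epigraph with M times the norm. Over 0 it is
    nonnegative by \<open>lower\<close>, and unlike the epigraph itself it is bounded above near 0
    as soon as it has a single point.\<close>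
  let ?K = "{(v - w, r + s) | v r w s. (v, r) \<in> fitz_epi B y \<and> M * norm w \<le> s}"
  have KI: "(v - w, r + s) \<in> ?K" if "(v, r) \<in> fitz_epi B y" "M * norm w \<le> s" for v r w s
    using that by blast
  have "convex ?K"
  proof (rule convexI, clarify)
    fix \<alpha> \<beta> :: real and v1 w1 v2 w2 :: 'a and r1 s1 r2 s2 :: real
    assume *: "0 \<le> \<alpha>" "0 \<le> \<beta>" "\<alpha> + \<beta> = 1" "(v1, r1) \<in> fitz_epi B y" "(v2, r2) \<in> fitz_epi B y"
      "M * norm w1 \<le> s1" "M * norm w2 \<le> s2"
    have "\<alpha> *\<^sub>R (v1, r1) + \<beta> *\<^sub>R (v2, r2) \<in> fitz_epi B y"
      using * by (intro convexD[OF convex_fitz_epi])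
    moreover have "M * norm (\<alpha> *\<^sub>R w1 + \<beta> *\<^sub>R w2) \<le> \<alpha> * s1 + \<beta> * s2"
    proof -
      have "M * norm (\<alpha> *\<^sub>R w1 + \<beta> *\<^sub>R w2) \<le> M * (\<alpha> * norm w1 + \<beta> * norm w2)"
        using * M norm_triangle_ineq[of "\<alpha> *\<^sub>R w1" "\<beta> *\<^sub>R w2"] by (intro mult_left_mono) auto
      also have "\<dots> = \<alpha> * (M * norm w1) + \<beta> * (M * norm w2)" by (simp add: algebra_simps)
      also have "\<dots> \<le> \<alpha> * s1 + \<beta> * s2" using * by (intro add_mono mult_left_mono)
      finally show ?thesis .
    qed
    ultimately show "\<exists>v r w s. \<alpha> *\<^sub>R (v1 - w1, r1 + s1) + \<beta> *\<^sub>R (v2 - w2, r2 + s2) = (v - w, r + s) \<and>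
        (v, r) \<in> fitz_epi B y \<and> M * norm w \<le> s"
      by (intro exI[of _ "\<alpha> *\<^sub>R v1 + \<beta> *\<^sub>R v2"] exI[of _ "\<alpha> * r1 + \<beta> * r2"]
          exI[of _ "\<alpha> *\<^sub>R w1 + \<beta> *\<^sub>R w2"] exI[of _ "\<alpha> * s1 + \<beta> * s2"])
        (simp add: algebra_simps)
  qed
  moreover have "0 \<le> r" if "(0, r) \<in> ?K" for r
    using that lower by force
  moreover
  obtain w0 r0 where w0: "(w0, r0) \<in> fitz_epi B y"
    using \<open>B w \<noteq> {}\<close> fitz_epi_graph[OF B] by blast
  have "\<exists>r\<le>r0 + M * (norm w0 + 1). (v, r) \<in> ?K" if v: "norm v < 1" for v
  proof (intro exI conjI)
    have "norm (w0 - v) \<le> norm w0 + 1"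
      using norm_triangle_ineq4[of w0 v] v by linarith
    then show "r0 + M * norm (w0 - v) \<le> r0 + M * (norm w0 + 1)"
      using M by (simp add: mult_left_mono)
    show "(v, r0 + M * norm (w0 - v)) \<in> ?K"
      using KI[OF w0, of "w0 - v"] by simp
  qed
  ultimately obtain f :: "'a \<Rightarrow>\<^sub>L real" where f: "\<And>v r. (v, r) \<in> ?K \<Longrightarrow> blinfun_apply f v \<le> r"
    using Hahn_Banach_epigraph[of ?K 1 "r0 + M * (norm w0 + 1)"] zero_less_one by blast
  have "f \<in> B y"
  proof (rule fitz_epi_minorant[OF B])
    fix v r assume "(v, r) \<in> fitz_epi B y"
    from f[OF KI[OF this, of 0 0]] show "blinfun_apply f v \<le> r" by simp
  qed
  then show ?thesis by blast
qed

text \<open>The closed convex sets \<open>F n\<close> cover the domain, so by Baire one of them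
  contains a ball, about some x0. A point u of the domain beyond x on the line from x0 lies in some
  \<open>F m\<close>, and convexity carries the ball from x0 to x. Membership of a whole ball in
  \<open>F N\<close> bounds the norms of the values of B near x.\<close>

lemma locally_bounded_interior:
  fixes B :: "'a::banach set_op"
  assumes B: "maximally_monotone B" and x: "x \<in> interior (op_dom B)"
  obtains \<rho> K where "\<rho> > 0" "cball x \<rho> \<subseteq> op_dom B"
    "\<And>v b. v \<in> cball x \<rho> \<Longrightarrow> b \<in> B v \<Longrightarrow> norm b \<le> K"
proof -
  \<comment> \<open>The factor 1 + norm (y - x) allows for the linear growth in y of c (v - y),
    where c is a value of B at v; by monotonicity this dominates b (v - y).\<close>
  define F where "F = (\<lambda>n. {v. \<forall>y. \<forall>b\<in>B y. blinfun_apply b (v - y) \<le> n * (1 + norm (y - x))})"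
  have closed: "closed (F n)" for n
  proof -
    have "F n = (\<Inter>y. \<Inter>b\<in>B y. {v. blinfun_apply b (v - y) \<le> n * (1 + norm (y - x))})"
      by (auto simp: F_def)
    moreover have "closed {v. blinfun_apply b (v - y) \<le> n * (1 + norm (y - x))}" for b y
      by (intro closed_Collect_le continuous_intros)
    ultimately show ?thesis by (simp only:) (intro closed_INT ballI)
  qed
  have convex: "convex (F n)" for n
  proof (rule convexI)
    fix v w and \<alpha> \<beta> :: real assume *: "v \<in> F n" "w \<in> F n" "0 \<le> \<alpha>" "0 \<le> \<beta>" "\<alpha> + \<beta> = 1"
    show "\<alpha> *\<^sub>R v + \<beta> *\<^sub>R w \<in> F n"
      unfolding F_def
    proof (intro CollectI allI ballI)
      fix y b assume b: "b \<in> B y"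
      have "\<alpha> *\<^sub>R v + \<beta> *\<^sub>R w - y = \<alpha> *\<^sub>R (v - y) + \<beta> *\<^sub>R (w - y)"
        using * by (simp add: algebra_simps flip: scaleR_add_left)
      then have "blinfun_apply b (\<alpha> *\<^sub>R v + \<beta> *\<^sub>R w - y)
          = \<alpha> * blinfun_apply b (v - y) + \<beta> * blinfun_apply b (w - y)"
        by (simp add: blinfun.add_right blinfun.scaleR_right)
      also have "\<dots> \<le> n * (1 + norm (y - x))"
        using * b by (intro convex_bound_le) (auto simp: F_def)
      finally show "blinfun_apply b (\<alpha> *\<^sub>R v + \<beta> *\<^sub>R w - y) \<le> n * (1 + norm (y - x))" .
    qed
  qed
  have mono: "F m \<subseteq> F n" if "m \<le> n" for m n
  proof -
    have "m * (1 + norm (y - x)) \<le> n * (1 + norm (y - x))" for y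
      using that by (intro mult_right_mono) auto
    then show ?thesis unfolding F_def by (blast intro: order_trans)
  qed
  have cover: "\<exists>n::nat. v \<in> F n" if v: "v \<in> op_dom B" for v
  proof -
    obtain c where c: "c \<in> B v" using v by (auto simp: op_dom_def)
    obtain n :: nat where n: "norm c * (1 + norm (v - x)) \<le> n" using real_arch_simple by blast
    have "v \<in> F n"
      unfolding F_def
    proof (intro CollectI allI ballI)
      fix y b assume b: "b \<in> B y"
      have "blinfun_apply b (v - y) \<le> blinfun_apply c (v - y)"
        using maximally_monotoneD(1)[OF B c b] by (simp add: blinfun.diff_left)
      also have "\<dots> \<le> norm c * norm (v - y)" using norm_blinfun[of c "v - y"] by simp
      also have "\<dots> \<le> norm c * ((1 + norm (v - x)) * (1 + norm (y - x)))"
      proof (intro mult_left_mono)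
        have "norm (v - y) \<le> norm (v - x) + norm (y - x)"
          using norm_triangle_ineq4[of "v - x" "y - x"] by simp
        moreover have "0 \<le> norm (v - x) * norm (y - x)" by simp
        moreover have "(1 + norm (v - x)) * (1 + norm (y - x))
            = 1 + norm (v - x) + norm (y - x) + norm (v - x) * norm (y - x)"
          by (simp add: algebra_simps)
        ultimately show "norm (v - y) \<le> (1 + norm (v - x)) * (1 + norm (y - x))"
          by linarith
      qed auto
      also have "\<dots> = (norm c * (1 + norm (v - x))) * (1 + norm (y - x))"
        by (simp only: mult.assoc)
      also have "\<dots> \<le> n * (1 + norm (y - x))"
        using n by (rule mult_right_mono) simp
      finally show "blinfun_apply b (v - y) \<le> n * (1 + norm (y - x))" .
    qed
    then show ?thesis by blast
  qed
  obtain r where r: "r > 0" "ball x r \<subseteq> op_dom B" using x by (auto simp: mem_interior)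
  have "\<exists>n::nat. interior (F n) \<noteq> {}"
  proof (rule ccontr)
    assume "\<not> ?thesis"
    then have "Met_TC.mtopology interior_of \<Union>(range (\<lambda>n::nat. F n)) = {}"
      using closed by (intro Met_TC.metric_Baire_category_alt) (auto simp: complete_UNIV)
    then have "interior (\<Union>(range (\<lambda>n::nat. F n))) = {}" by simp
    moreover have "ball x r \<subseteq> interior (\<Union>(range (\<lambda>n::nat. F n)))"
      using cover r by (intro interior_maximal) auto
    ultimately show False using r by auto
  qed
  then obtain n :: nat and x0 e where e: "e > 0" "ball x0 e \<subseteq> F n"
    by (meson all_not_in_conv mem_interior)
  obtain \<mu> where \<mu>: "0 < \<mu>" and "\<mu> * norm (x0 - x) < r"
    using small_factor[OF r(1), of "norm (x0 - x)"] by blast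
  define u where "u = x - \<mu> *\<^sub>R (x0 - x)"
  then have "u \<in> op_dom B" using r by (intro subsetD[OF r(2)]) (use \<mu> \<open>\<mu> * norm (x0 - x) < r\<close> in \<open>simp add: u_def dist_norm\<close>)
  then obtain m :: nat where m: "u \<in> F m" using cover by blast
  define N where "N = real (max m n)"
  define \<alpha> \<beta> where "\<alpha> = \<mu> / (1 + \<mu>)" and "\<beta> = 1 / (1 + \<mu>)"
  have ab: "\<alpha> > 0" "\<beta> > 0" "\<alpha> + \<beta> = 1" "\<beta> * \<mu> = \<alpha>"
    using \<mu> by (auto simp: \<alpha>_def \<beta>_def add_divide_distrib[symmetric])
  define \<eta> where "\<eta> = min (\<alpha> * e / 2) (r / 2)"
  have pos: "\<alpha> * e > 0" using ab e by simp
  have \<eta>: "\<eta> > 0" "\<eta> < r" "\<eta> < \<alpha> * e" using pos r by (auto simp: \<eta>_def min_def)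
  have ball: "x + v \<in> F N" if v: "norm v \<le> \<eta>" for v
  proof -
    have "norm ((1 / \<alpha>) *\<^sub>R v) < e"
      using v \<eta> ab by (simp add: pos_divide_less_eq mult.commute)
    then have "x0 + (1 / \<alpha>) *\<^sub>R v \<in> F n"
      by (intro subsetD[OF e(2)]) (simp add: dist_norm)
    moreover have "F n \<subseteq> F N" "F m \<subseteq> F N" by (intro mono; simp add: N_def)+
    ultimately have "\<alpha> *\<^sub>R (x0 + (1 / \<alpha>) *\<^sub>R v) + \<beta> *\<^sub>R u \<in> F N"
      using m ab by (intro convexD[OF convex]) auto
    moreover have "\<alpha> *\<^sub>R (x0 + (1 / \<alpha>) *\<^sub>R v) + \<beta> *\<^sub>R u = x + v"
    proof -
      have "\<alpha> *\<^sub>R (x0 + (1 / \<alpha>) *\<^sub>R v) + \<beta> *\<^sub>R u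
          = (\<alpha> - \<beta> * \<mu>) *\<^sub>R x0 + (\<beta> + \<beta> * \<mu>) *\<^sub>R x + (\<alpha> * (1 / \<alpha>)) *\<^sub>R v"
        by (simp only: u_def scaleR_add_right scaleR_diff_right scaleR_add_left scaleR_diff_left
            scaleR_scaleR) simp
      then show ?thesis using ab by (simp add: add.commute)
    qed
    ultimately show ?thesis by simp
  qed
  show ?thesis
  proof (rule that[of "\<eta> / 2" "2 * (N * (1 + \<eta>)) / \<eta>"])
    show "\<eta> / 2 > 0" using \<eta> by simp
    show "cball x (\<eta> / 2) \<subseteq> op_dom B" using \<eta> r by (intro order_trans[OF _ r(2)]) auto
    fix y b assume y: "y \<in> cball x (\<eta> / 2)" and b: "b \<in> B y"
    have N: "N \<ge> 0" by (simp add: N_def)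
    have ny: "norm (y - x) \<le> \<eta> / 2" using y by (simp add: dist_norm norm_minus_commute)
    have "\<eta> / 2 * norm b \<le> N * (1 + \<eta>)"
    proof (rule blinfun_norm_bound_ball)
      fix w :: 'a assume w: "norm w \<le> \<eta> / 2"
      have "norm (y - x + w) \<le> \<eta>"
        using norm_triangle_ineq[of "y - x" w] w ny by linarith
      then have "x + (y - x + w) \<in> F N" by (rule ball)
      then have "blinfun_apply b (x + (y - x + w) - y) \<le> N * (1 + norm (y - x))"
        using b unfolding F_def by blast
      then have "blinfun_apply b w \<le> N * (1 + norm (y - x))" by simp
      also have "\<dots> \<le> N * (1 + \<eta>)"
        using ny N \<eta> by (intro mult_left_mono) auto
      finally show "blinfun_apply b w \<le> N * (1 + \<eta>)" .
    qed (use \<eta> in simp)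
    then show "norm b \<le> 2 * (N * (1 + \<eta>)) / \<eta>" using \<eta> by (simp add: field_simps)
  qed
qed

subsection \<open>Operators of type (FPV)\<close>

lemma type_FPV_D:
  assumes "type_FPV A" "open U" "convex U" "u \<in> U" "A u \<noteq> {}" "x \<in> U" "a \<notin> A x"
  obtains y b where "y \<in> U" "b \<in> A y" "blinfun_apply (a - b) (x - y) < 0"
proof -
  have "U \<inter> op_dom A \<noteq> {}" using assms by (auto simp: op_dom_def)
  moreover have "(x, a) \<notin> gra A" using assms by (simp add: gra_def)
  ultimately have "\<not> monotonically_related (x, a) (gra A \<inter> (U \<times> UNIV))"
    using assms unfolding type_FPV_def by blast
  then show ?thesis
    using that by (auto simp: monotonically_related_def gra_def not_le)
qed

text \<open>The dichotomy comes from testing the type (FPV) property at \<open>x\<close>, on a thin tube around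
  \<open>[0, x]\<close>, against a large multiple of a functional norming \<open>x\<close>.\<close>

lemma type_FPV_approx:
  fixes A :: "'a::real_normed_vector set_op"
  assumes fpv: "type_FPV A" and A0: "A 0 \<noteq> {}" and V: "open V" "convex V" "0 \<in> V" "x \<in> V" and \<delta>: "\<delta> > 0"
  obtains y a where "y \<in> V" "a \<in> A y"
    "norm (y - x) < \<delta> \<and> - \<delta> \<le> blinfun_apply a (x - y) \<or> L \<le> blinfun_apply a (x - y)"
proof (cases "A x = {}")
  case False
  then obtain a where "a \<in> A x" by blast
  then show ?thesis using that[of x a] V \<delta> by simp
next
  case True
  obtain f :: "'a \<Rightarrow>\<^sub>L real" where fx: "blinfun_apply f x = norm x"
    and f: "\<And>v. blinfun_apply f v \<le> norm v"
    using norming_functional[of x] by blast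
  \<comment> \<open>Along the tube f (x - y) differs from the distance by at most 2 * \<eta>. Points
    at distance at least \<delta> therefore have f (x - y) >= \<delta> / 2, and \<tau> makes this
    exceed L; for the nearer points \<eta> is thin enough that \<tau> f (x - y) >=
    -\<delta>.\<close>
  define \<tau> where "\<tau> = 2 * (\<bar>L\<bar> + 1) / \<delta>"
  have \<tau>: "\<tau> > 0" "\<tau> * (\<delta> / 2) = \<bar>L\<bar> + 1" using \<delta> by (auto simp: \<tau>_def)
  define \<eta> where "\<eta> = min (\<delta> / 4) (\<delta> / (2 * \<tau>))"
  have \<eta>: "\<eta> > 0" "2 * \<eta> \<le> \<delta> / 2" "2 * \<eta> * \<tau> \<le> \<delta>"
  proof -
    show "\<eta> > 0" using \<delta> \<tau> by (simp add: \<eta>_def)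
    show "2 * \<eta> \<le> \<delta> / 2" by (simp add: \<eta>_def)
    have "\<eta> \<le> \<delta> / (2 * \<tau>)" by (simp add: \<eta>_def)
    then show "2 * \<eta> * \<tau> \<le> \<delta>" using \<tau> by (simp add: pos_le_divide_eq mult.commute mult.left_commute)
  qed
  define T where "T = (\<Union>u\<in>closed_segment 0 x. \<Union>e\<in>ball 0 \<eta>. {u + e})"
  have T: "open T" "convex T"
    unfolding T_def by (intro open_sums convex_sums; simp)+
  have TI: "u + 0 \<in> T" if "u \<in> closed_segment 0 x" for u
    unfolding T_def using that \<eta> by force
  have "0 \<in> V \<inter> T" "x \<in> V \<inter> T" using V TI[of 0] TI[of x] by auto
  \<comment> \<open>As \<open>A x\<close> is empty, it does not contain \<tau> f, so type (FPV) must
    supply a graph point over the tube that violates monotonicity with (x, \<tau> f).\<close>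
  then obtain y a where y: "y \<in> V \<inter> T" and a: "a \<in> A y"
    and lt: "blinfun_apply (\<tau> *\<^sub>R f - a) (x - y) < 0"
    using type_FPV_D[OF fpv, of "V \<inter> T" 0 x "\<tau> *\<^sub>R f"] V T A0 True
    by (metis convex_Int empty_iff open_Int)
  obtain \<theta> e where \<theta>: "0 \<le> \<theta>" "\<theta> \<le> 1" and e: "norm e < \<eta>" and ye: "y = \<theta> *\<^sub>R x + e"
    using y by (auto simp: T_def in_segment)
  have eq: "x - y = (1 - \<theta>) *\<^sub>R x - e" by (simp add: ye algebra_simps)
  have "blinfun_apply f (x - y) = (1 - \<theta>) * norm x - blinfun_apply f e"
    unfolding eq by (simp add: blinfun.diff_right blinfun.scaleR_right fx)
  moreover have "norm (y - x) \<le> (1 - \<theta>) * norm x + norm e"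
    using norm_triangle_ineq4[of "(1 - \<theta>) *\<^sub>R x" e] \<theta> unfolding norm_minus_commute[of y] eq by simp
  ultimately have fge: "norm (y - x) - 2 * \<eta> \<le> blinfun_apply f (x - y)"
    using f[of e] e by linarith
  have agt: "\<tau> * blinfun_apply f (x - y) < blinfun_apply a (x - y)"
    using lt by (simp add: blinfun.diff_left blinfun.scaleR_left)
  show ?thesis
  proof (cases "norm (y - x) < \<delta>")
    case True
    have "- 2 * \<eta> \<le> blinfun_apply f (x - y)" using fge norm_ge_zero[of "y - x"] by linarith
    then have "\<tau> * (- 2 * \<eta>) \<le> \<tau> * blinfun_apply f (x - y)" using \<tau> by (intro mult_left_mono) auto
    then have "- \<delta> \<le> blinfun_apply a (x - y)"
      using agt \<eta>(3) by (simp add: mult.commute mult.left_commute)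
    then show ?thesis using that[of y a] y a True by blast
  next
    case False
    then have "\<delta> / 2 \<le> blinfun_apply f (x - y)" using fge \<eta> by linarith
    then have "\<tau> * (\<delta> / 2) \<le> \<tau> * blinfun_apply f (x - y)" using \<tau> by (intro mult_left_mono) auto
    then have "L \<le> blinfun_apply a (x - y)" using agt \<tau> by linarith
    then show ?thesis using that[of y a] y a by blast
  qed
qed

subsection \<open>Drops\<close>

text \<open>The hull is sliced into the sets (1 - \<phi>) ball + \<phi> z. Requiring \<phi> < 1
  leaves only open balls of positive radius when \<rho> > 0, so openness is immediate.\<close>

definition open_drop :: "'a::real_normed_vector \<Rightarrow> real \<Rightarrow> 'a set" where
  "open_drop z \<rho> = (\<Union>\<phi>\<in>{0..<1}. ball (\<phi> *\<^sub>R z) ((1 - \<phi>) * \<rho>))"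

lemma open_dropI: "0 \<le> \<phi> \<Longrightarrow> \<phi> < 1 \<Longrightarrow> norm (y - \<phi> *\<^sub>R z) < (1 - \<phi>) * \<rho> \<Longrightarrow> y \<in> open_drop z \<rho>"
  unfolding open_drop_def by (force simp: dist_norm norm_minus_commute)

lemma open_dropE:
  assumes "y \<in> open_drop z \<rho>"
  obtains \<phi> w where "0 \<le> \<phi>" "\<phi> < 1" "norm w < \<rho>" "y = (1 - \<phi>) *\<^sub>R w + \<phi> *\<^sub>R z"
proof -
  obtain \<phi> where \<phi>: "0 \<le> \<phi>" "\<phi> < 1" "norm (y - \<phi> *\<^sub>R z) < (1 - \<phi>) * \<rho>"
    using assms by (auto simp: open_drop_def dist_norm norm_minus_commute)
  show ?thesis
  proof (rule that[OF \<phi>(1,2)])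
    let ?w = "(1 / (1 - \<phi>)) *\<^sub>R (y - \<phi> *\<^sub>R z)"
    show "norm ?w < \<rho>" using \<phi> by (simp add: pos_divide_less_eq mult.commute)
    have "(1 - \<phi>) *\<^sub>R ?w = y - \<phi> *\<^sub>R z" using \<phi> by (simp del: scaleR_diff_left scaleR_diff_right)
    then show "y = (1 - \<phi>) *\<^sub>R ?w + \<phi> *\<^sub>R z" by (metis diff_add_cancel)
  qed
qed

lemma open_open_drop: "open (open_drop z \<rho>)"
  unfolding open_drop_def by auto

lemma convex_open_drop: "convex (open_drop z \<rho>)"
proof (rule convexI)
  fix x y and \<alpha> \<beta> :: real
  assume "x \<in> open_drop z \<rho>" "y \<in> open_drop z \<rho>" and ab: "0 \<le> \<alpha>" "0 \<le> \<beta>" "\<alpha> + \<beta> = 1"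
  then obtain \<phi> \<psi> where
    1: "0 \<le> \<phi>" "\<phi> < 1" "norm (x - \<phi> *\<^sub>R z) < (1 - \<phi>) * \<rho>" and
    2: "0 \<le> \<psi>" "\<psi> < 1" "norm (y - \<psi> *\<^sub>R z) < (1 - \<psi>) * \<rho>"
    by (auto simp: open_drop_def dist_norm norm_minus_commute)
  have "norm (\<alpha> *\<^sub>R (x - \<phi> *\<^sub>R z) + \<beta> *\<^sub>R (y - \<psi> *\<^sub>R z))
      \<le> \<alpha> * norm (x - \<phi> *\<^sub>R z) + \<beta> * norm (y - \<psi> *\<^sub>R z)"
    using norm_triangle_ineq[of "\<alpha> *\<^sub>R (x - \<phi> *\<^sub>R z)" "\<beta> *\<^sub>R (y - \<psi> *\<^sub>R z)"] ab by simp
  moreover have "\<alpha> * norm (x - \<phi> *\<^sub>R z) + \<beta> * norm (y - \<psi> *\<^sub>R z) < \<alpha> * ((1 - \<phi>) * \<rho>) + \<beta> * ((1 - \<psi>) * \<rho>)"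
  proof (cases "\<alpha> = 0")
    case True
    then show ?thesis using ab 2 by simp
  next
    case False
    then show ?thesis using ab 1 2 by (intro add_less_le_mono mult_strict_left_mono mult_left_mono) auto
  qed
  moreover have "\<alpha> * ((1 - \<phi>) * \<rho>) + \<beta> * ((1 - \<psi>) * \<rho>) = (1 - (\<alpha> * \<phi> + \<beta> * \<psi>)) * \<rho>"
  proof -
    have "\<alpha> * ((1 - \<phi>) * \<rho>) + \<beta> * ((1 - \<psi>) * \<rho>) = ((\<alpha> + \<beta>) - (\<alpha> * \<phi> + \<beta> * \<psi>)) * \<rho>"
      by (simp add: algebra_simps)
    then show ?thesis using ab by simp
  qed
  moreover have "\<alpha> *\<^sub>R (x - \<phi> *\<^sub>R z) + \<beta> *\<^sub>R (y - \<psi> *\<^sub>R z)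
      = \<alpha> *\<^sub>R x + \<beta> *\<^sub>R y - (\<alpha> * \<phi> + \<beta> * \<psi>) *\<^sub>R z"
    by (simp add: algebra_simps)
  moreover have "\<alpha> * \<phi> + \<beta> * \<psi> < 1"
    using convex_bound_lt[of \<phi> 1 \<psi> \<alpha> \<beta>] 1 2 ab by simp
  ultimately show "\<alpha> *\<^sub>R x + \<beta> *\<^sub>R y \<in> open_drop z \<rho>"
    using ab 1 2 by (intro open_dropI[of "\<alpha> * \<phi> + \<beta> * \<psi>"]) auto
qed

lemma scaleR_apex_in_open_drop: "\<rho> > 0 \<Longrightarrow> 0 \<le> s \<Longrightarrow> s < 1 \<Longrightarrow> s *\<^sub>R z \<in> open_drop z \<rho>"
  by (rule open_dropI[of s]) auto

lemma norm_open_drop: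
  assumes "y \<in> open_drop z \<rho>"
  shows "norm y \<le> norm z + \<rho>"
proof -
  obtain \<phi> w where w: "0 \<le> \<phi>" "\<phi> < 1" "norm w < \<rho>" "y = (1 - \<phi>) *\<^sub>R w + \<phi> *\<^sub>R z"
    using open_dropE[OF assms] by metis
  have "norm y \<le> (1 - \<phi>) * norm w + \<phi> * norm z"
    using norm_triangle_ineq[of "(1 - \<phi>) *\<^sub>R w" "\<phi> *\<^sub>R z"] w by simp
  also have "\<dots> \<le> 1 * norm w + 1 * norm z" using w by (intro add_mono mult_right_mono) auto
  finally show ?thesis using w by simp
qed

lemma interior_closure_shrink:
  fixes D :: "'a::real_normed_vector set"
  assumes D: "convex D" and y: "y \<in> closure D" and u: "u \<in> interior D" and \<mu>: "0 < \<mu>" "\<mu> \<le> 1"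
  shows "(1 - \<mu>) *\<^sub>R y + \<mu> *\<^sub>R u \<in> interior D"
proof -
  obtain r where r: "r > 0" "ball u r \<subseteq> D" using u by (auto simp: mem_interior)
  \<comment> \<open>The ball about u, scaled by \<mu>, has radius \<mu> * r. Half of it pays for
    replacing y by y2, the other half becomes the ball about the new point.\<close>
  obtain y2 where y2: "y2 \<in> D" "dist y2 y < \<mu> * r / 2"
    using y r \<mu> unfolding closure_approachable by (metis half_gt_zero mult_pos_pos)
  have "ball ((1 - \<mu>) *\<^sub>R y + \<mu> *\<^sub>R u) (\<mu> * r / 2) \<subseteq> D"
  proof
    fix v assume v: "v \<in> ball ((1 - \<mu>) *\<^sub>R y + \<mu> *\<^sub>R u) (\<mu> * r / 2)"
    define w where "w = (1 / \<mu>) *\<^sub>R (v - (1 - \<mu>) *\<^sub>R y2)"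
    have eq: "v - (1 - \<mu>) *\<^sub>R y2 - \<mu> *\<^sub>R u = (v - ((1 - \<mu>) *\<^sub>R y + \<mu> *\<^sub>R u)) - (1 - \<mu>) *\<^sub>R (y2 - y)"
      by (simp add: algebra_simps)
    have "norm (v - (1 - \<mu>) *\<^sub>R y2 - \<mu> *\<^sub>R u)
        \<le> norm (v - ((1 - \<mu>) *\<^sub>R y + \<mu> *\<^sub>R u)) + (1 - \<mu>) * norm (y2 - y)"
      using norm_triangle_ineq4[of "v - ((1 - \<mu>) *\<^sub>R y + \<mu> *\<^sub>R u)" "(1 - \<mu>) *\<^sub>R (y2 - y)"] \<mu>
      unfolding eq by simp
    also have "\<dots> < \<mu> * r / 2 + 1 * (\<mu> * r / 2)"
    proof (rule add_less_le_mono)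
      show "norm (v - ((1 - \<mu>) *\<^sub>R y + \<mu> *\<^sub>R u)) < \<mu> * r / 2"
        using v by (simp add: dist_norm norm_minus_commute)
      show "(1 - \<mu>) * norm (y2 - y) \<le> 1 * (\<mu> * r / 2)"
        using y2 \<mu> by (intro mult_mono) (auto simp: dist_norm)
    qed
    finally have "norm (v - (1 - \<mu>) *\<^sub>R y2 - \<mu> *\<^sub>R u) < \<mu> * r" by simp
    moreover have "w - u = (1 / \<mu>) *\<^sub>R (v - (1 - \<mu>) *\<^sub>R y2 - \<mu> *\<^sub>R u)"
      using \<mu> by (simp add: w_def scaleR_diff_right)
    ultimately have "norm (w - u) < r" using \<mu> by (simp add: pos_divide_less_eq mult.commute)
    then have "w \<in> D" using r by (auto simp: dist_norm norm_minus_commute)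
    then have "(1 - \<mu>) *\<^sub>R y2 + \<mu> *\<^sub>R w \<in> D" using y2 \<mu> by (intro convexD[OF D]) auto
    moreover have "(1 - \<mu>) *\<^sub>R y2 + \<mu> *\<^sub>R w = v" using \<mu> by (simp add: w_def)
    ultimately show "v \<in> D" by simp
  qed
  moreover have "\<mu> * r / 2 > 0" using r \<mu> by simp
  ultimately show ?thesis unfolding mem_interior by blast
qed

subsection \<open>The sum theorem in normalised position\<close>

text \<open>The pair (0, 0) in the graph of A gives a y >= 0 for every a in \<open>A y\<close>,
  which is how the base point enters most estimates.\<close>

locale normalised_sum =
  fixes A B :: "'a::real_normed_vector set_op" and \<rho> K :: real
  assumes A: "maximally_monotone A" and fpv: "type_FPV A" and B: "maximally_monotone B"
    and A0: "0 \<in> A 0" and star: "\<And>y r. A y \<noteq> {} \<Longrightarrow> 0 \<le> r \<Longrightarrow> r \<le> 1 \<Longrightarrow> A (r *\<^sub>R y) \<noteq> {}"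
    and \<rho>: "\<rho> > 0" and B_ball: "\<And>v. norm v \<le> \<rho> \<Longrightarrow> B v \<noteq> {}"
    and K: "\<And>v b. norm v \<le> \<rho> \<Longrightarrow> b \<in> B v \<Longrightarrow> norm b \<le> K"
begin

section \<open>Bounds for B over the drop and behaviour at the boundary\<close>

lemma K_nonneg: "K \<ge> 0"
  using B_ball[of 0] K[of 0] \<rho> by (force intro: order_trans[OF norm_ge_zero])

lemma B_lower_bound:
  assumes "norm v \<le> \<rho>" "b \<in> B y"
  shows "- K * norm (y - v) \<le> blinfun_apply b (y - v)"
proof -
  obtain c where c: "c \<in> B v" "norm c \<le> K" using B_ball K assms by blast
  have "blinfun_apply c (y - v) \<le> blinfun_apply b (y - v)"
    using maximally_monotoneD(1)[OF B assms(2) c(1)] by (simp add: blinfun.diff_left)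
  moreover have "- blinfun_apply c (y - v) \<le> norm c * norm (y - v)"
    using norm_blinfun[of c "y - v"] by simp
  moreover have "norm c * norm (y - v) \<le> K * norm (y - v)" using c by (intro mult_right_mono) auto
  ultimately show ?thesis by simp
qed

text \<open>Both y - w and z - y are nonnegative multiples of z - w, so the bound in the direction y
  - w rescales to z - y with the same constant K. For \<phi> = 0 the first multiple vanishes, but
  then y lies in the ball and b itself is bounded.\<close>

lemma B_lower_bound_apex:
  assumes y: "y \<in> open_drop z \<rho>" and b: "b \<in> B y"
  shows "- K * norm (z - y) \<le> blinfun_apply b (z - y)"
proof -
  obtain \<phi> w where w: "0 \<le> \<phi>" "\<phi> < 1" "norm w < \<rho>" "y = (1 - \<phi>) *\<^sub>R w + \<phi> *\<^sub>R z"
    using open_dropE[OF y] by metis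
  show ?thesis
  proof (cases "\<phi> = 0")
    case True
    then have "norm b \<le> K" using w b K[of w b] by simp
    then have "norm b * norm (z - y) \<le> K * norm (z - y)" by (intro mult_right_mono) auto
    then show ?thesis using norm_blinfun[of b "z - y"] by simp
  next
    case False
    have 1: "y - w = \<phi> *\<^sub>R (z - w)" "z - y = (1 - \<phi>) *\<^sub>R (z - w)"
      using w by (auto simp: algebra_simps)
    have "\<phi> * (- K * norm (z - w)) \<le> \<phi> * blinfun_apply b (z - w)"
      using B_lower_bound[OF less_imp_le[OF w(3)] b] w False unfolding 1
      by (simp add: blinfun.scaleR_right mult.left_commute)
    moreover have "\<phi> > 0" using w False by simp
    ultimately have "- K * norm (z - w) \<le> blinfun_apply b (z - w)"
      by (simp only: mult_le_cancel_left_pos)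
    then have "(1 - \<phi>) * (- K * norm (z - w)) \<le> (1 - \<phi>) * blinfun_apply b (z - w)"
      using w by (intro mult_left_mono) auto
    then show ?thesis using w unfolding 1(2) by (simp add: blinfun.scaleR_right mult.left_commute)
  qed
qed

lemma ball_fitz_dom: "ball 0 \<rho> \<subseteq> fitz_dom B"
  using B_ball fitz_dom_graph[OF B] by force

lemma ball_interior: "norm v < \<rho> \<Longrightarrow> v \<in> interior (fitz_dom B)"
  using interior_maximal[OF ball_fitz_dom] by auto

lemma interior_domain: "x \<in> interior (fitz_dom B) \<Longrightarrow> B x \<noteq> {}"
  using B_ball K by (intro interior_fitz_dom[OF B \<rho>, of K]) (meson all_not_in_conv less_imp_le)+

text \<open>A functional n that supports \<open>fitz_dom B\<close> at y can be added to b in any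
  nonnegative multiple. Since n w < 1 <= n y and y lies between w and z, n increases strictly from y
  to z, so large multiples violate \<open>rel\<close>.\<close>

lemma not_related_at_boundary:
  assumes y: "y \<in> open_drop z \<rho>" "y \<notin> interior (fitz_dom B)" and b: "b \<in> B y"
    and rel: "\<And>b. b \<in> B y \<Longrightarrow> 0 \<le> blinfun_apply (c - b) (z - y)"
  shows False
proof -
  obtain n :: "'a \<Rightarrow>\<^sub>L real" where n: "1 \<le> blinfun_apply n y"
    and le: "\<And>d. d \<in> fitz_dom B \<Longrightarrow> blinfun_apply n d \<le> 1"
    using separating_functional[OF convex_fitz_dom \<rho> ball_fitz_dom y(2)] by blast
  have normal: "b + \<tau> *\<^sub>R n \<in> B y" if "\<tau> \<ge> 0" for \<tau>
  proof (rule maximally_monotoneD(2)[OF B])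
    fix v d assume d: "d \<in> B v"
    have "0 \<le> \<tau> * (blinfun_apply n y - blinfun_apply n v)"
      using le[OF fitz_dom_graph[OF B d]] n that by simp
    then show "0 \<le> blinfun_apply (b + \<tau> *\<^sub>R n - d) (y - v)"
      using maximally_monotoneD(1)[OF B b d]
      by (simp add: blinfun.add_left blinfun.diff_left blinfun.scaleR_left blinfun.diff_right
          right_diff_distrib)
  qed
  obtain \<phi> w where w: "0 \<le> \<phi>" "\<phi> < 1" "norm w < \<rho>" "y = (1 - \<phi>) *\<^sub>R w + \<phi> *\<^sub>R z"
    using open_dropE[OF y(1)] by metis
  have nw: "blinfun_apply n w < 1"
  proof (cases "w = 0")
    case False
    \<comment> \<open>The vector s w has norm halfway between norm w and \<rho>, hence still lies in
      the ball; n <= 1 there makes the inequality at w strict.\<close>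
    define s where "s = (norm w + \<rho>) / (2 * norm w)"
    have s: "s > 1" using w False by (simp add: s_def)
    have "norm (s *\<^sub>R w) < \<rho>"
      using w False \<rho> by (simp add: s_def abs_of_pos add_pos_pos)
    then have "s * blinfun_apply n w \<le> 1"
      using le[of "s *\<^sub>R w"] subsetD[OF ball_fitz_dom, of "s *\<^sub>R w"]
      by (simp add: blinfun.scaleR_right)
    show ?thesis
    proof (rule ccontr)
      assume "\<not> blinfun_apply n w < 1"
      then have "s * 1 \<le> s * blinfun_apply n w" using s by (intro mult_left_mono) auto
      then show False using s \<open>s * blinfun_apply n w \<le> 1\<close> by linarith
    qed
  qed simp
  have ny: "blinfun_apply n y = (1 - \<phi>) * blinfun_apply n w + \<phi> * blinfun_apply n z"
    unfolding w(4) by (simp add: blinfun.add_right blinfun.scaleR_right)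
  have "(1 - \<phi>) * blinfun_apply n w < (1 - \<phi>) * 1"
    using nw w by (intro mult_strict_left_mono) auto
  then have "\<phi> * 1 < \<phi> * blinfun_apply n z" using n ny by simp
  then have nz: "1 < blinfun_apply n z" using w(1) by (rule mult_left_less_imp_less)
  have "blinfun_apply n (z - y) = (1 - \<phi>) * (blinfun_apply n z - blinfun_apply n w)"
    using ny by (simp add: blinfun.diff_right algebra_simps)
  then have pos: "blinfun_apply n (z - y) > 0" using nw nz w by simp
  define \<tau> where "\<tau> = (\<bar>blinfun_apply (c - b) (z - y)\<bar> + 1) / blinfun_apply n (z - y)"
  have "\<tau> \<ge> 0" "\<tau> * blinfun_apply n (z - y) = \<bar>blinfun_apply (c - b) (z - y)\<bar> + 1"
    using pos by (auto simp: \<tau>_def)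
  moreover have "0 \<le> blinfun_apply (c - b) (z - y) - \<tau> * blinfun_apply n (z - y)"
    using rel[OF normal[OF \<open>\<tau> \<ge> 0\<close>]]
    by (simp add: blinfun.add_left blinfun.diff_left blinfun.scaleR_left)
  ultimately show False by linarith
qed

text \<open>An upper bound in the single direction z - y' controls the whole norm: going back from
  y' by \<kappa> (z - y') ends near w, well inside the ball on which B is bounded, and monotonicity
  can be tested there against every small perturbation u.\<close>

lemma B_bound_near:
  assumes y: "y \<in> open_drop z \<rho>"
  obtains \<delta> M where "\<delta> > 0"
    "\<And>y' b. y' \<in> open_drop z \<rho> \<Longrightarrow> norm (y' - y) \<le> \<delta> \<Longrightarrow> b \<in> B y' \<Longrightarrow>
      blinfun_apply b (z - y') \<le> C \<Longrightarrow> norm b \<le> M"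
proof -
  obtain \<phi> w where w: "0 \<le> \<phi>" "\<phi> < 1" "norm w < \<rho>" "y = (1 - \<phi>) *\<^sub>R w + \<phi> *\<^sub>R z"
    using open_dropE[OF y] by metis
  \<comment> \<open>The ratio of y - w to z - y, so that y - \<kappa> (z - y) = w. The map y' to y'
    - \<kappa> (z - y') stretches distances by 1 + \<kappa>, which explains the radius \<sigma> / (1
    + \<kappa>) below.\<close>
  define \<kappa> where "\<kappa> = \<phi> / (1 - \<phi>)"
  have \<kappa>: "\<kappa> \<ge> 0" "\<kappa> * (1 - \<phi>) = \<phi>" using w by (auto simp: \<kappa>_def)
  have wy: "y - \<kappa> *\<^sub>R (z - y) = w"
  proof -
    have "z - y = (1 - \<phi>) *\<^sub>R (z - w)" using w by (simp add: algebra_simps)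
    then have "\<kappa> *\<^sub>R (z - y) = \<phi> *\<^sub>R (z - w)" using \<kappa> by simp
    moreover have "y = w + \<phi> *\<^sub>R (z - w)" using w by (simp add: algebra_simps)
    ultimately show ?thesis by simp
  qed
  define \<sigma> where "\<sigma> = (\<rho> - norm w) / 2"
  have \<sigma>: "\<sigma> > 0" "norm w + 2 * \<sigma> = \<rho>" using w by (auto simp: \<sigma>_def field_simps)
  define R where "R = 2 * norm z + \<rho>"
  define M where "M = (\<kappa> * C + K * (\<kappa> * R + \<sigma>)) / \<sigma>"
  show ?thesis
  proof (rule that[of "\<sigma> / (1 + \<kappa>)" M])
    show "\<sigma> / (1 + \<kappa>) > 0" using \<sigma> \<kappa> by simp
    fix y' b assume y': "y' \<in> open_drop z \<rho>" "norm (y' - y) \<le> \<sigma> / (1 + \<kappa>)" and b: "b \<in> B y'"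
      and C: "blinfun_apply b (z - y') \<le> C"
    have R: "norm (z - y') \<le> R"
      using norm_triangle_ineq4[of z y'] norm_open_drop[OF y'(1)] by (simp add: R_def)
    have "y' - \<kappa> *\<^sub>R (z - y') = w + (1 + \<kappa>) *\<^sub>R (y' - y)"
      unfolding wy[symmetric] by (simp add: algebra_simps)
    moreover have "norm ((1 + \<kappa>) *\<^sub>R (y' - y)) \<le> \<sigma>"
      using y'(2) \<kappa> by (simp add: pos_le_divide_eq mult.commute)
    ultimately have near: "norm (y' - \<kappa> *\<^sub>R (z - y')) \<le> norm w + \<sigma>"
      using norm_triangle_ineq[of w "(1 + \<kappa>) *\<^sub>R (y' - y)"] by simp
    have "\<sigma> * norm b \<le> \<kappa> * C + K * (\<kappa> * R + \<sigma>)"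
    proof (rule blinfun_norm_bound_ball)
      fix u :: 'a assume u: "norm u \<le> \<sigma>"
      define v where "v = y' - \<kappa> *\<^sub>R (z - y') + u"
      have "norm v \<le> \<rho>"
        using norm_triangle_ineq[of "y' - \<kappa> *\<^sub>R (z - y')" u] near u \<sigma> unfolding v_def by linarith
      then have "- K * norm (y' - v) \<le> blinfun_apply b (y' - v)" using b by (rule B_lower_bound)
      moreover have eq: "y' - v = \<kappa> *\<^sub>R (z - y') - u" by (simp add: v_def)
      moreover have "K * norm (y' - v) \<le> K * (\<kappa> * R + \<sigma>)"
      proof (rule mult_left_mono[OF _ K_nonneg])
        have "\<kappa> * norm (z - y') \<le> \<kappa> * R" using R \<kappa> by (intro mult_left_mono)
        then show "norm (y' - v) \<le> \<kappa> * R + \<sigma>"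
          unfolding eq using norm_triangle_ineq4[of "\<kappa> *\<^sub>R (z - y')" u] u \<kappa> by simp
      qed
      moreover have "blinfun_apply b (y' - v) = \<kappa> * blinfun_apply b (z - y') - blinfun_apply b u"
        unfolding eq by (simp only: blinfun.diff_right[of b _ u] blinfun.scaleR_right real_scaleR_def)
      moreover have "\<kappa> * blinfun_apply b (z - y') \<le> \<kappa> * C" using C \<kappa> by (intro mult_left_mono)
      ultimately show "blinfun_apply b u \<le> \<kappa> * C + K * (\<kappa> * R + \<sigma>)" by linarith
    qed (use \<sigma> in simp)
    then show "norm b \<le> M" using \<sigma> by (simp add: M_def pos_le_divide_eq mult.commute)
  qed
qed

text \<open>The two monotonicity inequalities, against \<open>(0, 0)\<close> and against a point over \<open>y\<close>, together
  bound \<open>a (z - y')\<close> from below; for \<open>y'\<close> near \<open>x\<close> the bound stays finite as \<open>\<mu> \<rightarrow> 0\<close>.\<close>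

lemma pairing_lower_bound:
  fixes a :: "'b::real_normed_vector \<Rightarrow>\<^sub>L real"
  assumes x: "x = (1 - \<mu>) *\<^sub>R y + (\<mu> * \<epsilon>) *\<^sub>R z"
    and \<mu>: "0 < \<mu>" "\<mu> \<le> 1" and \<epsilon>: "0 < \<epsilon>" "\<epsilon> < 1"
    and zero: "0 \<le> blinfun_apply a y'" and d: "- d \<le> blinfun_apply a (y' - y)"
    and g: "g = blinfun_apply a (x - y')"
  shows "((1 - \<mu>) * ((g - d) / \<mu>) + g) / \<epsilon> \<le> blinfun_apply a (z - y')"
proof -
  define P Q Y h m where "P = blinfun_apply a y" and "Q = blinfun_apply a z"
    and "Y = blinfun_apply a y'" and "h = (g - d) / \<mu>" and "m = (1 - \<mu>) * h + g"
  have ax: "blinfun_apply a x = P + \<mu> * (\<epsilon> * Q - P)"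
    unfolding x
    by (simp add: blinfun.add_right blinfun.diff_right blinfun.scaleR_right P_def Q_def algebra_simps)
  have gY: "P + \<mu> * (\<epsilon> * Q - P) = g + Y" using g ax by (simp add: blinfun.diff_right Y_def)
  have "g - d \<le> \<mu> * (\<epsilon> * Q - P)"
    using d gY by (simp add: blinfun.diff_right P_def Y_def)
  then have h: "h \<le> \<epsilon> * Q - P" using \<mu> by (simp add: h_def pos_divide_le_eq mult.commute)
  have "(1 - \<mu>) * h \<le> (1 - \<mu>) * (\<epsilon> * Q - P)" using h \<mu> by (intro mult_left_mono) auto
  \<comment> \<open>This is (1 - \<mu>) (\<epsilon> z - y) = \<epsilon> z - x under a; it trades the
    unknown value at y for the value at x.\<close>
  moreover have "(1 - \<mu>) * (\<epsilon> * Q - P) = \<epsilon> * Q - (P + \<mu> * (\<epsilon> * Q - P))" by (simp add: algebra_simps)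
  ultimately have up: "(1 - \<mu>) * h \<le> \<epsilon> * Q - (g + Y)" using gY by simp
  then have "m \<le> \<epsilon> * Q" using zero by (simp add: m_def Y_def)
  then have "m / \<epsilon> \<le> Q" using \<epsilon> by (simp add: pos_divide_le_eq mult.commute)
  then have "(1 - \<epsilon>) * (m / \<epsilon>) \<le> (1 - \<epsilon>) * Q" using \<epsilon> by (intro mult_left_mono) auto
  moreover have "(1 - \<epsilon>) * (m / \<epsilon>) = m / \<epsilon> - m" using \<epsilon> by (simp add: field_simps)
  moreover have "(1 - \<epsilon>) * Q = Q - \<epsilon> * Q" by (simp add: algebra_simps)
  ultimately have "m / \<epsilon> \<le> Q - Y" using up by (simp add: m_def)
  then show ?thesis by (simp add: m_def h_def Q_def Y_def blinfun.diff_right)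
qed

text \<open>Approaching y through V guarantees that every point of \<open>gra A\<close> found by
  type (FPV) lies where B has a value, so that \<open>rel\<close> turns a lower bound for a (z - y')
  into an upper bound for b (z - y'). The element c of \<open>A y\<close> keeps a (y' - y) from
  being very negative.\<close>

lemma domain_at_boundary:
  assumes y: "y \<in> open_drop z \<rho>" "y \<in> closure (fitz_dom B)" and c: "c \<in> A y"
    and rel: "\<And>y a b. a \<in> A y \<Longrightarrow> b \<in> B y \<Longrightarrow> 0 \<le> blinfun_apply (z' - a - b) (z - y)"
  shows "B y \<noteq> {}"
proof -
  define V where "V = open_drop z \<rho> \<inter> interior (fitz_dom B)"
  have V: "open V" "convex V"
    by (auto simp: V_def open_open_drop convex_open_drop convex_fitz_dom intro!: convex_Int convex_interior)
  have V0: "0 \<in> V"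
    using scaleR_apex_in_open_drop[OF \<rho>, of 0 z] ball_interior[of 0] \<rho> by (simp add: V_def)
  obtain \<epsilon> where \<epsilon>: "0 < \<epsilon>" "\<epsilon> < 1" and "\<epsilon> * norm z < \<rho>"
  proof -
    obtain t where "0 < t" "t \<le> 1 / 2" "t * norm z < \<rho>"
      using small_factor[OF \<rho>, of "norm z"] by blast
    then show ?thesis using that[of t] by simp
  qed
  then have u: "\<epsilon> *\<^sub>R z \<in> interior (fitz_dom B)" using \<epsilon> by (intro ball_interior) simp
  \<comment> \<open>Here norm (x - y) = \<mu> * norm (\<epsilon> z - y), and y' will be within \<mu>
    of x; hence norm (y' - y) <= \<mu> * Q.\<close>
  define Q where "Q = norm (\<epsilon> *\<^sub>R z - y) + 1"
  have Q: "Q > 0" by (simp add: Q_def add_nonneg_pos)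
  define R where "R = 2 * (norm z + \<rho>)"
  have R: "norm (z - y') \<le> R" "norm (y' - y) \<le> R" if "y' \<in> open_drop z \<rho>" for y'
    using norm_open_drop[OF that] norm_open_drop[OF y(1)] norm_triangle_ineq4[of z y']
      norm_triangle_ineq4[of y' y] \<rho> by (auto simp: R_def)
  define C where "C = norm z' * R + (Q * norm c + 2) / \<epsilon>"
  \<comment> \<open>Large enough to exclude the second alternative of
    \<open>type_FPV_approx\<close>: R * norm c absorbs d, and the remainder exceeds by 1 what z' and
    the lower bound -K * R for b permit.\<close>
  define L where "L = R * norm c + (norm z' + K) * R + 1"
  obtain \<delta>1 M where \<delta>1: "\<delta>1 > 0" and M: "\<And>y' b. y' \<in> open_drop z \<rho> \<Longrightarrow> norm (y' - y) \<le> \<delta>1 \<Longrightarrow>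
      b \<in> B y' \<Longrightarrow> blinfun_apply b (z - y') \<le> C \<Longrightarrow> norm b \<le> M"
    using B_bound_near[OF y(1), of C] by metis
  show ?thesis
  proof (rule domain_closed_if_bounded[OF B B_ball[of 0]])
    fix \<delta> :: real assume \<delta>: "\<delta> > 0"
    obtain \<mu> where \<mu>: "0 < \<mu>" "\<mu> \<le> 1 / 2" "\<mu> * Q < min \<delta> \<delta>1"
      using small_factor[of "min \<delta> \<delta>1" Q] \<delta> \<delta>1 by auto
    then have \<mu>: "0 < \<mu>" "\<mu> \<le> 1" "\<mu> * Q < \<delta>" "\<mu> * Q \<le> \<delta>1" by auto
    define x where "x = (1 - \<mu>) *\<^sub>R y + (\<mu> * \<epsilon>) *\<^sub>R z"
    have xeq: "x = (1 - \<mu>) *\<^sub>R y + \<mu> *\<^sub>R (\<epsilon> *\<^sub>R z)" by (simp add: x_def)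
    have "x \<in> V"
      unfolding V_def
    proof
      show "x \<in> open_drop z \<rho>"
        unfolding xeq using y \<mu> \<epsilon> scaleR_apex_in_open_drop[OF \<rho>, of \<epsilon> z]
        by (intro convexD[OF convex_open_drop]) auto
      show "x \<in> interior (fitz_dom B)"
        unfolding xeq using interior_closure_shrink[OF convex_fitz_dom y(2) u \<mu>(1,2)] .
    qed
    \<comment> \<open>The tolerance is \<mu> itself: then g and d are both of order \<mu>, and the
      quotient (g - d) / \<mu> in \<open>pairing_lower_bound\<close> stays bounded below as \<mu>
      tends to 0.\<close>
    then obtain y' a where y': "y' \<in> V" and a: "a \<in> A y'" and alt:
      "norm (y' - x) < \<mu> \<and> - \<mu> \<le> blinfun_apply a (x - y') \<or> L \<le> blinfun_apply a (x - y')"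
      using type_FPV_approx[OF fpv _ V V0 _ \<mu>(1), of x L] A0 by blast
    have drop: "y' \<in> open_drop z \<rho>" using y' by (simp add: V_def)
    obtain b where b: "b \<in> B y'" using interior_domain y' by (auto simp: V_def)
    have zero: "0 \<le> blinfun_apply a y'" using maximally_monotoneD(1)[OF A a A0] by simp
    define g d where "g = blinfun_apply a (x - y')" and "d = norm (y' - y) * norm c"
    have "- d \<le> blinfun_apply a (y' - y)"
      using maximally_monotoneD(1)[OF A a c] norm_blinfun[of c "y' - y"]
      by (simp add: d_def blinfun.diff_left mult.commute)
    note lower = pairing_lower_bound[OF x_def \<mu>(1,2) \<epsilon> zero this g_def]
    have up: "blinfun_apply b (z - y') \<le> norm z' * R - blinfun_apply a (z - y')"
    proof -
      have "blinfun_apply z' (z - y') \<le> norm z' * norm (z - y')"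
        using norm_blinfun[of z' "z - y'"] by simp
      also have "\<dots> \<le> norm z' * R" using R[OF drop] by (intro mult_left_mono) auto
      finally show ?thesis using rel[OF a b] by (simp add: blinfun.diff_left)
    qed
    have near: "norm (y' - x) < \<mu> \<and> - \<mu> \<le> g"
    proof (rule ccontr)
      assume "\<not> ?thesis"
      then have gL: "L \<le> g" using alt unfolding g_def by blast
      have "R \<ge> 0" using \<rho> by (simp add: R_def)
      have "d \<le> R * norm c" using R(2)[OF drop] by (simp add: d_def mult_right_mono)
      moreover have "0 \<le> (norm z' + K) * R" using K_nonneg \<open>R \<ge> 0\<close> by simp
      ultimately have "0 \<le> (g - d) / \<mu>" using gL \<mu> by (simp add: L_def)
      then have "g / \<epsilon> \<le> ((1 - \<mu>) * ((g - d) / \<mu>) + g) / \<epsilon>"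
        using \<mu> \<epsilon> mult_nonneg_nonneg[of "1 - \<mu>" "(g - d) / \<mu>"] by (intro divide_right_mono) linarith+
      moreover have "g \<le> g / \<epsilon>"
      proof -
        have "0 \<le> R * norm c" using \<open>R \<ge> 0\<close> by simp
        then have "0 \<le> g" using gL \<open>0 \<le> (norm z' + K) * R\<close> unfolding L_def by linarith
        then show ?thesis using \<epsilon> by (simp add: pos_le_divide_eq mult_left_le)
      qed
      ultimately have "L \<le> blinfun_apply a (z - y')" using lower gL by linarith
      moreover have "- K * R \<le> blinfun_apply b (z - y')"
        using B_lower_bound_apex[OF drop b] mult_left_mono[OF R(1)[OF drop] K_nonneg] by linarith
      moreover have "0 \<le> R * norm c" using \<open>R \<ge> 0\<close> by simp
      ultimately show False using up by (simp add: L_def algebra_simps)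
    qed
    have ny: "norm (y' - y) \<le> \<mu> * Q"
    proof -
      have "x - y = \<mu> *\<^sub>R (\<epsilon> *\<^sub>R z - y)" by (simp add: x_def algebra_simps)
      then have "norm (x - y) = \<mu> * norm (\<epsilon> *\<^sub>R z - y)" using \<mu> by simp
      then show ?thesis
        using norm_triangle_ineq[of "y' - x" "x - y"] near by (simp add: Q_def algebra_simps)
    qed
    have "- (Q * norm c + 2) / \<epsilon> \<le> blinfun_apply a (z - y')"
    proof -
      have "d \<le> \<mu> * Q * norm c" unfolding d_def using ny by (intro mult_right_mono) auto
      then have "\<mu> * (- (1 + Q * norm c)) \<le> g - d" using near by (simp add: algebra_simps)
      then have "- (1 + Q * norm c) \<le> (g - d) / \<mu>"
        using \<mu> by (simp add: pos_le_divide_eq mult.commute)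
      then have "(1 - \<mu>) * (- (1 + Q * norm c)) \<le> (1 - \<mu>) * ((g - d) / \<mu>)"
        using \<mu> by (intro mult_left_mono) auto
      moreover have "0 \<le> \<mu> * (1 + Q * norm c)" using \<mu> Q by simp
      moreover have "(1 - \<mu>) * (- (1 + Q * norm c)) = - (1 + Q * norm c) + \<mu> * (1 + Q * norm c)"
        by (simp add: algebra_simps)
      ultimately have "- (Q * norm c + 2) \<le> (1 - \<mu>) * ((g - d) / \<mu>) + g"
        using near \<mu> by linarith
      then have "- (Q * norm c + 2) / \<epsilon> \<le> ((1 - \<mu>) * ((g - d) / \<mu>) + g) / \<epsilon>"
        using \<epsilon> by (intro divide_right_mono) auto
      then show ?thesis using lower by linarith
    qed
    moreover have "- (Q * norm c + 2) / \<epsilon> = - ((Q * norm c + 2) / \<epsilon>)"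
      by (rule minus_divide_left[symmetric])
    ultimately have "blinfun_apply b (z - y') \<le> C" using up unfolding C_def by linarith
    then have "norm b \<le> M" using M[OF drop _ b] ny \<mu> by simp
    then show "\<exists>y'. \<exists>b\<in>B y'. norm (y' - y) < \<delta> \<and> norm b \<le> M"
      using b ny \<mu> by (intro exI[of _ y'] bexI[of _ b]) auto
  qed (use \<rho> in simp)
qed

text \<open>On a segment from 0 leaving the interior of \<open>fitz_dom B\<close>, the exit point v
  is in dom A by \<open>star\<close>. There \<open>domain_at_boundary\<close> provides a value of B
  and \<open>not_related_at_boundary\<close> forbids one, so y never leaves the interior.\<close>

lemma domain_in_drop:
  assumes y: "y \<in> open_drop z \<rho>" "A y \<noteq> {}"
    and rel: "\<And>y a b. a \<in> A y \<Longrightarrow> b \<in> B y \<Longrightarrow> 0 \<le> blinfun_apply (z' - a - b) (z - y)"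
  shows "B y \<noteq> {}"
proof (cases "y \<in> interior (fitz_dom B)")
  case True
  then show ?thesis by (rule interior_domain)
next
  case False
  have "closed_segment 0 y \<inter> frontier (interior (fitz_dom B)) \<noteq> {}"
    using False ball_interior[of 0] \<rho> by (intro connected_Int_frontier) auto
  then obtain v where v: "v \<in> closed_segment 0 y" "v \<in> closure (interior (fitz_dom B))"
    "v \<notin> interior (fitz_dom B)"
    by (auto simp: frontier_def)
  have cl: "v \<in> closure (fitz_dom B)" using v closure_mono[OF interior_subset] by blast
  obtain r where r: "0 \<le> r" "r \<le> 1" "v = r *\<^sub>R y" using v by (auto simp: in_segment)
  obtain a where a: "a \<in> A v" using star[OF y(2) r(1,2)] r by blast
  have drop: "v \<in> open_drop z \<rho>"
    using convexD[OF convex_open_drop scaleR_apex_in_open_drop[OF \<rho>, of 0 z] y(1), of "1 - r" r] r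
    by simp
  obtain b where "b \<in> B v" using domain_at_boundary[OF drop cl a rel] by blast
  then have False
    using rel[OF a] by (intro not_related_at_boundary[OF drop v(3), of b "z' - a"])
  then show ?thesis ..
qed

section \<open>The Fitzpatrick inequality for the sum\<close>

lemma no_gap:
  assumes e: "e > 0"
    and gap: "\<And>y a b. a \<in> A y \<Longrightarrow> b \<in> B y \<Longrightarrow> e \<le> blinfun_apply (z' - a - b) (z - y)"
  shows False
proof -
  \<comment> \<open>The gap and the lower bound for b combine to e <= C * norm (z - y) - a (z - y);
    t and \<delta> are then chosen to make the right side smaller than e.\<close>
  define C where "C = norm z' + K"
  have C: "C \<ge> 0" using K_nonneg by (simp add: C_def)
  obtain t where t: "0 < t" "t \<le> 1 / 2" and "t * (C * norm z) < e / 4"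
    using small_factor[of "e / 4" "C * norm z"] e by auto
  then have Ct: "C * (t * norm z) < e / 4" by (simp add: mult.left_commute)
  obtain \<delta> where \<delta>: "0 < \<delta>" "\<delta> * (C + 2) < e / 4"
    using small_factor[of "e / 4" "C + 2"] e by auto
  then have C\<delta>: "C * \<delta> + 2 * \<delta> < e / 4" by (simp add: algebra_simps)
  define R where "R = 2 * norm z + \<rho>"
  have R: "norm (z - y) \<le> R" if "y \<in> open_drop z \<rho>" for y
    using norm_open_drop[OF that] norm_triangle_ineq4[of z y] by (simp add: R_def)
  define x where "x = (1 - t) *\<^sub>R z"
  have "x \<in> open_drop z \<rho>" "0 \<in> open_drop z \<rho>"
    using scaleR_apex_in_open_drop[OF \<rho>, of "1 - t" z] scaleR_apex_in_open_drop[OF \<rho>, of 0 z] t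
    by (auto simp: x_def)
  \<comment> \<open>The threshold C * R is the largest value that C * norm (z - y) can reach on the
    drop, so the second alternative contradicts the inequality \<open>main\<close> directly.\<close>
  then obtain y a where y: "y \<in> open_drop z \<rho>" and a: "a \<in> A y" and alt:
    "norm (y - x) < \<delta> \<and> - \<delta> \<le> blinfun_apply a (x - y) \<or> C * R \<le> blinfun_apply a (x - y)"
    using type_FPV_approx[OF fpv _ open_open_drop convex_open_drop _ _ \<delta>(1), of z \<rho> x "C * R"] A0
    by blast
  have "B y \<noteq> {}"
  proof (rule domain_in_drop[OF y])
    fix y a b assume "a \<in> A y" "b \<in> B y"
    from gap[OF this] e show "0 \<le> blinfun_apply (z' - a - b) (z - y)" by linarith
  qed (use a in blast)
  then obtain b where b: "b \<in> B y" by blast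
  define g where "g = blinfun_apply a (x - y)"
  have "0 \<le> blinfun_apply a y" using maximally_monotoneD(1)[OF A a A0] by simp
  then have "g \<le> (1 - t) * blinfun_apply a z"
    by (simp add: g_def x_def blinfun.diff_right blinfun.scaleR_right)
  \<comment> \<open>Since a y >= 0, the value at x = (1 - t) z bounds a z from below. This carries
    the estimate from x to z, where a (z - y) = g + t * a z.\<close>
  then have "t / (1 - t) * g \<le> t / (1 - t) * ((1 - t) * blinfun_apply a z)"
    using t by (intro mult_left_mono) auto
  then have "t / (1 - t) * g \<le> t * blinfun_apply a z" using t by simp
  moreover have "blinfun_apply a (z - y) = g + t * blinfun_apply a z"
  proof -
    have "z - y = (x - y) + t *\<^sub>R z" by (simp add: x_def algebra_simps)
    then show ?thesis by (simp only: g_def blinfun.add_right blinfun.scaleR_right real_scaleR_def)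
  qed
  ultimately have low: "g + t / (1 - t) * g \<le> blinfun_apply a (z - y)" by simp
  have bz: "- K * norm (z - y) \<le> blinfun_apply b (z - y)" by (rule B_lower_bound_apex[OF y b])
  have "blinfun_apply z' (z - y) \<le> norm z' * norm (z - y)"
    using norm_blinfun[of z' "z - y"] by simp
  then have main: "e \<le> C * norm (z - y) - blinfun_apply a (z - y)"
    using gap[OF a b] bz by (simp add: blinfun.diff_left blinfun.add_left C_def algebra_simps)
  have q: "0 \<le> t / (1 - t)" "t / (1 - t) \<le> 1" using t by (auto simp: divide_le_eq)
  from alt show False
  proof
    assume *: "norm (y - x) < \<delta> \<and> - \<delta> \<le> blinfun_apply a (x - y)"
    have "t / (1 - t) * (- \<delta>) \<le> t / (1 - t) * g"
      using * q by (intro mult_left_mono) (auto simp: g_def)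
    moreover have "t / (1 - t) * \<delta> \<le> 1 * \<delta>" using q \<delta> by (intro mult_right_mono) auto
    ultimately have "- 2 * \<delta> \<le> blinfun_apply a (z - y)" using low * by (simp add: g_def)
    moreover have "norm (z - y) \<le> t * norm z + \<delta>"
    proof -
      have eq: "z - y = t *\<^sub>R z - (y - x)" by (simp add: x_def algebra_simps)
      show ?thesis unfolding eq using norm_triangle_ineq4[of "t *\<^sub>R z" "y - x"] * t by simp
    qed
    then have "C * norm (z - y) \<le> C * (t * norm z) + C * \<delta>"
      using mult_left_mono[OF _ C] by (metis distrib_left)
    ultimately show False using main Ct C\<delta> e by linarith
  next
    assume *: "C * R \<le> blinfun_apply a (x - y)"
    have "R \<ge> 0" using \<rho> by (simp add: R_def)
    then have "0 \<le> g" using * mult_nonneg_nonneg[OF C \<open>R \<ge> 0\<close>] unfolding g_def by linarith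
    then have "g \<le> blinfun_apply a (z - y)" using low q mult_nonneg_nonneg[of "t / (1 - t)" g] by linarith
    then show False using main * mult_left_mono[OF R[OF y] C] e unfolding g_def by linarith
  qed
qed

text \<open>By \<open>no_gap\<close> the Fitzpatrick function of \<open>A + B\<close> dominates the pairing, with equality at
  \<open>(z, z')\<close>; linearising there and splitting by the Hahn-Banach theorem decouples \<open>A\<close> from \<open>B\<close>.\<close>

lemma fitz_sum_lower_bound:
  assumes rel: "\<And>y a b. a \<in> A y \<Longrightarrow> b \<in> B y \<Longrightarrow> 0 \<le> blinfun_apply (z' - a - b) (z - y)"
    and u: "fitz_le A x u (r + blinfun_apply u z + blinfun_apply z' x)"
    and v: "fitz_le B x v (s + blinfun_apply v z)"
  shows "0 \<le> r + s + blinfun_apply z' z"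
proof (rule ccontr)
  define \<eta> where "\<eta> = - (r + s + blinfun_apply z' z)"
  assume "\<not> ?thesis"
  then have \<eta>: "\<eta> > 0" by (simp add: \<eta>_def)
  \<comment> \<open>If the linearised inequality fails by \<eta>, moving from (z, z') by a step t
    towards (x, u + v) gains t * \<eta> to first order against a quadratic error t * t * q. For
    small t at least t * \<eta> / 2 remains, a uniform gap at the moved pair.\<close>
  define U X q where "U = u + v - z'" and "X = x - z" and "q = blinfun_apply U X"
  obtain t where t: "0 < t" "t \<le> 1 / 2" "t * \<bar>q\<bar> < \<eta> / 2"
    using small_factor[of "\<eta> / 2" "\<bar>q\<bar>"] \<eta> by auto
  have "- \<bar>q\<bar> \<le> q" by simp
  then have "t * (t * (- \<bar>q\<bar>)) \<le> t * (t * q)" using t by (intro mult_left_mono) auto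
  moreover have "t * (t * \<bar>q\<bar>) \<le> t * (\<eta> / 2)" using t by (intro mult_left_mono) auto
  ultimately have tq: "t * \<eta> / 2 \<le> t * \<eta> + t * (t * q)" by linarith
  have "0 < t * \<eta> / 2" using t \<eta> by simp
  then show False
  proof (rule no_gap)
    fix y a b assume a: "a \<in> A y" and b: "b \<in> B y"
    define F0 F1 where
      "F0 = blinfun_apply (a + b) z + blinfun_apply z' y - blinfun_apply (a + b) y" and
      "F1 = blinfun_apply (a + b) x + blinfun_apply (u + v) y - blinfun_apply (a + b) y"
    have "F0 \<le> blinfun_apply z' z"
      using rel[OF a b] by (simp add: F0_def blinfun.diff_left blinfun.add_left blinfun.diff_right)
    then have 0: "(1 - t) * F0 \<le> (1 - t) * blinfun_apply z' z" using t by (intro mult_left_mono) auto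
    have "F1 \<le> blinfun_apply (u + v) z + blinfun_apply z' x - \<eta> - blinfun_apply z' z"
      using fitz_leD[OF u a] fitz_leD[OF v b] by (simp add: F1_def \<eta>_def blinfun.add_left)
    then have 1: "t * F1 \<le> t * (blinfun_apply (u + v) z + blinfun_apply z' x - \<eta> - blinfun_apply z' z)"
      using t by (intro mult_left_mono) auto
    have "blinfun_apply (z' + t *\<^sub>R U - a - b) (z + t *\<^sub>R X - y)
        = blinfun_apply (z' + t *\<^sub>R U) (z + t *\<^sub>R X) - ((1 - t) * F0 + t * F1)"
      unfolding F0_def F1_def U_def X_def
      by (simp add: blinfun.add_left blinfun.add_right blinfun.diff_left blinfun.diff_right
          blinfun.scaleR_left blinfun.scaleR_right algebra_simps)
    moreover have "blinfun_apply (z' + t *\<^sub>R U) (z + t *\<^sub>R X) = blinfun_apply z' z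
        + t * (blinfun_apply z' x + blinfun_apply (u + v) z - 2 * blinfun_apply z' z) + t * (t * q)"
      unfolding q_def U_def X_def
      by (simp add: blinfun.add_left blinfun.add_right blinfun.diff_left blinfun.diff_right
          blinfun.scaleR_left blinfun.scaleR_right algebra_simps)
    ultimately have "t * \<eta> + t * (t * q) \<le> blinfun_apply (z' + t *\<^sub>R U - a - b) (z + t *\<^sub>R X - y)"
      using 0 1 by (simp add: algebra_simps)
    then show "t * \<eta> / 2 \<le> blinfun_apply (z' + t *\<^sub>R U - a - b) (z + t *\<^sub>R X - y)"
      using tq by linarith
  qed
qed

text \<open>The functional w plays the role of a Lagrange multiplier for the constraint that A and B
  are evaluated at the same point. It turns the joint inequality into a sum of two terms over
  independent graph points, one for A and one for B.\<close>

lemma sum_maximal: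
  assumes rel: "\<And>y a b. a \<in> A y \<Longrightarrow> b \<in> B y \<Longrightarrow> 0 \<le> blinfun_apply (z' - a - b) (z - y)"
  obtains a b where "a \<in> A z" "b \<in> B z" "z' = a + b"
proof -
  \<comment> \<open>The constraint x = y is relaxed to the perturbation x - y. Over 0 the set is
    nonnegative by \<open>fitz_sum_lower_bound\<close>; near 0 it is bounded above by using (0, 0)
    for A and the bounded values of B on the ball.\<close>
  define E where "E = {(x - y, r + s + blinfun_apply z' z) | x y r s. \<exists>u v.
      fitz_le A x u (r + blinfun_apply u z + blinfun_apply z' x) \<and> fitz_le B y v (s + blinfun_apply v z)}"
  have KI: "(x - y, r + s + blinfun_apply z' z) \<in> E"
    if "fitz_le A x u (r + blinfun_apply u z + blinfun_apply z' x)"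
      "fitz_le B y v (s + blinfun_apply v z)" for x y r s u v
    using that unfolding E_def by blast
  have KE: "\<exists>x y r s u v. p = (x - y, r + s + blinfun_apply z' z) \<and>
      fitz_le A x u (r + blinfun_apply u z + blinfun_apply z' x) \<and> fitz_le B y v (s + blinfun_apply v z)"
    if "p \<in> E" for p
    using that unfolding E_def by blast
  have "convex E"
  proof (rule convexI)
    fix p1 p2 and \<alpha> \<beta> :: real
    assume "p1 \<in> E" "p2 \<in> E" and ab: "0 \<le> \<alpha>" "0 \<le> \<beta>" "\<alpha> + \<beta> = 1"
    obtain x1 y1 r1 s1 u1 v1 where 1: "p1 = (x1 - y1, r1 + s1 + blinfun_apply z' z)"
      "fitz_le A x1 u1 (r1 + blinfun_apply u1 z + blinfun_apply z' x1)"
      "fitz_le B y1 v1 (s1 + blinfun_apply v1 z)"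
      using KE[OF \<open>p1 \<in> E\<close>] by blast
    obtain x2 y2 r2 s2 u2 v2 where 2: "p2 = (x2 - y2, r2 + s2 + blinfun_apply z' z)"
      "fitz_le A x2 u2 (r2 + blinfun_apply u2 z + blinfun_apply z' x2)"
      "fitz_le B y2 v2 (s2 + blinfun_apply v2 z)"
      using KE[OF \<open>p2 \<in> E\<close>] by blast
    define x y r s u v where "x = \<alpha> *\<^sub>R x1 + \<beta> *\<^sub>R x2" and "y = \<alpha> *\<^sub>R y1 + \<beta> *\<^sub>R y2"
      and "r = \<alpha> * r1 + \<beta> * r2" and "s = \<alpha> * s1 + \<beta> * s2"
      and "u = \<alpha> *\<^sub>R u1 + \<beta> *\<^sub>R u2" and "v = \<alpha> *\<^sub>R v1 + \<beta> *\<^sub>R v2"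
    note defs = x_def y_def r_def s_def u_def v_def
    have "fitz_le A x u (r + blinfun_apply u z + blinfun_apply z' x)"
      using fitz_le_convex[OF 1(2) 2(2) ab] unfolding defs
      by (simp add: blinfun.add_left blinfun.add_right blinfun.scaleR_left blinfun.scaleR_right algebra_simps)
    moreover have "fitz_le B y v (s + blinfun_apply v z)"
      using fitz_le_convex[OF 1(3) 2(3) ab] unfolding defs
      by (simp add: blinfun.add_left blinfun.scaleR_left algebra_simps)
    ultimately have "(x - y, r + s + blinfun_apply z' z) \<in> E" by (rule KI)
    moreover have "\<alpha> *\<^sub>R p1 + \<beta> *\<^sub>R p2 = (x - y, r + s + blinfun_apply z' z)"
    proof -
      have "blinfun_apply z' z = \<alpha> * blinfun_apply z' z + \<beta> * blinfun_apply z' z"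
        using ab by (metis distrib_right mult_1)
      then show ?thesis unfolding defs 1(1) 2(1) by (simp add: algebra_simps)
    qed
    ultimately show "\<alpha> *\<^sub>R p1 + \<beta> *\<^sub>R p2 \<in> E" by simp
  qed
  moreover have "0 \<le> r" if "(0, r) \<in> E" for r
    using KE[OF that] fitz_sum_lower_bound[OF rel] by auto
  moreover have "\<exists>r \<le> K * (\<rho> + norm z) + blinfun_apply z' z. (v, r) \<in> E" if v: "norm v < \<rho>" for v
  proof -
    obtain b where b: "b \<in> B (- v)" "norm b \<le> K" using B_ball[of "- v"] K[of "- v"] v by force
    have "fitz_le A 0 0 (0 + blinfun_apply 0 z + blinfun_apply z' 0)"
      using fitz_le_graph[OF A A0] by simp
    moreover have "fitz_le B (- v) b (blinfun_apply b (- v - z) + blinfun_apply b z)"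
      using fitz_le_graph[OF B b(1)] by (simp add: blinfun.diff_right)
    ultimately have "(0 - (- v), 0 + blinfun_apply b (- v - z) + blinfun_apply z' z) \<in> E" by (rule KI)
    moreover have "blinfun_apply b (- v - z) \<le> K * (\<rho> + norm z)"
    proof -
      have "blinfun_apply b (- v - z) \<le> norm b * norm (- v - z)"
        using norm_blinfun[of b "- v - z"] by simp
      also have "\<dots> \<le> K * (\<rho> + norm z)"
        using b v K_nonneg norm_triangle_ineq4[of "- v" z] by (intro mult_mono) auto
      finally show ?thesis .
    qed
    ultimately show ?thesis by (intro exI[of _ "blinfun_apply b (- v - z) + blinfun_apply z' z"]) simp
  qed
  ultimately obtain w :: "'a \<Rightarrow>\<^sub>L real" where w: "\<And>v r. (v, r) \<in> E \<Longrightarrow> blinfun_apply w v \<le> r"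
    using Hahn_Banach_epigraph[of E \<rho> "K * (\<rho> + norm z) + blinfun_apply z' z"] \<rho> by blast
  have split: "0 \<le> blinfun_apply (z' + w - a) (z - x) + blinfun_apply (- w - b) (z - y)"
    if a: "a \<in> A x" and b: "b \<in> B y" for x y a b
  proof -
    have "fitz_le A x a ((blinfun_apply a (x - z) - blinfun_apply z' x) + blinfun_apply a z + blinfun_apply z' x)"
      using fitz_le_graph[OF A a] by (simp add: blinfun.diff_right)
    moreover have "fitz_le B y b (blinfun_apply b (y - z) + blinfun_apply b z)"
      using fitz_le_graph[OF B b] by (simp add: blinfun.diff_right)
    ultimately have "blinfun_apply w (x - y)
        \<le> (blinfun_apply a (x - z) - blinfun_apply z' x) + blinfun_apply b (y - z) + blinfun_apply z' z"
      by (intro w KI)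
    then show ?thesis
      by (simp add: blinfun.diff_left blinfun.add_left blinfun.minus_left blinfun.diff_right)
  qed
  \<comment> \<open>A negative term for B would make every term for A positive, so z' + w would be
    in \<open>A z\<close>; at that very graph point the term for A vanishes, and the sum would be
    negative.\<close>
  have "- w \<in> B z"
  proof (rule ccontr)
    assume "- w \<notin> B z"
    then obtain y b where b: "b \<in> B y" "blinfun_apply (- w - b) (z - y) < 0"
      using maximally_monotoneD(2)[OF B, of "- w" z] by (meson not_le)
    have "z' + w \<in> A z"
      using split[OF _ b(1)] b(2) by (intro maximally_monotoneD(2)[OF A]) (smt (verit))
    from split[OF this b(1)] b(2) show False by simp
  qed
  moreover have "z' + w \<in> A z"
    using split[OF _ \<open>- w \<in> B z\<close>] by (intro maximally_monotoneD(2)[OF A]) simp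
  ultimately show ?thesis using that by simp
qed

end

subsection \<open>Translation to the general case\<close>

definition shift_op :: "'a::real_normed_vector \<Rightarrow> ('a \<Rightarrow>\<^sub>L real) \<Rightarrow> 'a set_op \<Rightarrow> 'a set_op" where
  "shift_op p c A = (\<lambda>x. {a. a + c \<in> A (x + p)})"

lemma maximally_monotone_shift:
  assumes A: "maximally_monotone A"
  shows "maximally_monotone (shift_op p c A)"
  unfolding maximally_monotone_iff
proof (intro conjI allI ballI impI)
  fix x y a b assume "a \<in> shift_op p c A x" "b \<in> shift_op p c A y"
  then show "0 \<le> blinfun_apply (a - b) (x - y)"
    using maximally_monotoneD(1)[OF A, of "a + c" "x + p" "b + c" "y + p"] by (simp add: shift_op_def)
next
  fix x a assume rel: "\<forall>y. \<forall>b\<in>shift_op p c A y. 0 \<le> blinfun_apply (a - b) (x - y)"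
  have "a + c \<in> A (x + p)"
  proof (rule maximally_monotoneD(2)[OF A])
    fix y b assume "b \<in> A y"
    then show "0 \<le> blinfun_apply (a + c - b) (x + p - y)"
      using rel[rule_format, of "b - c" "y - p"] by (simp add: shift_op_def algebra_simps)
  qed
  then show "a \<in> shift_op p c A x" by (simp add: shift_op_def)
qed

lemma type_FPV_shift:
  assumes A: "type_FPV A"
  shows "type_FPV (shift_op p c A)"
  unfolding type_FPV_def
proof (intro conjI allI impI)
  show "maximally_monotone (shift_op p c A)"
    using A by (intro maximally_monotone_shift) (simp add: type_FPV_def)
next
  fix U :: "'a set" and x a
  assume U: "open U \<and> convex U \<and> U \<inter> op_dom (shift_op p c A) \<noteq> {}"
    and x: "x \<in> U \<and> monotonically_related (x, a) (gra (shift_op p c A) \<inter> (U \<times> UNIV))"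
  show "(x, a) \<in> gra (shift_op p c A)"
  proof (rule ccontr)
    assume "(x, a) \<notin> gra (shift_op p c A)"
    then have nin: "a + c \<notin> A (x + p)" by (simp add: gra_def shift_op_def)
    obtain u where u: "u \<in> U" "shift_op p c A u \<noteq> {}" using U by (auto simp: op_dom_def)
    let ?V = "(+) p ` U"
    have "open ?V" "convex ?V" using U by (auto intro: open_translation convex_translation)
    moreover have "u + p \<in> ?V" "x + p \<in> ?V" using u x by (auto simp: add.commute)
    moreover have "A (u + p) \<noteq> {}" using u by (auto simp: shift_op_def)
    ultimately obtain y b where y: "y \<in> ?V" and b: "b \<in> A y"
      and lt: "blinfun_apply (a + c - b) (x + p - y) < 0"
      using type_FPV_D[OF A _ _ _ _ _ nin, of ?V "u + p"] by metis
    have "y - p \<in> U" "b - c \<in> shift_op p c A (y - p)" using y b by (auto simp: shift_op_def)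
    then have "0 \<le> blinfun_apply (a - (b - c)) (x - (y - p))"
      using x by (auto simp: monotonically_related_def gra_def)
    with lt show False by (simp add: algebra_simps)
  qed
qed

theorem theorem3p3:
  fixes A B :: "'a::banach \<Rightarrow> ('a \<Rightarrow>\<^sub>L real) set"
  assumes "maximally_monotone A" and "maximally_monotone B"
    and "star_of_set (op_dom A) \<inter> interior (op_dom B) \<noteq> {}"
    and "type_FPV A"
  shows "maximally_monotone (sum_op A B)"
proof -
  obtain p where p: "p \<in> star_of_set (op_dom A)" "p \<in> interior (op_dom B)" using assms(3) by blast
  have seg: "closed_segment p y \<subseteq> op_dom A" if "y \<in> op_dom A" for y
    using p(1) that by (auto simp: star_of_set_def)
  obtain c where c: "c \<in> A p" using p(1) by (auto simp: star_of_set_def op_dom_def)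
  obtain \<rho> K where \<rho>: "\<rho> > 0" "cball p \<rho> \<subseteq> op_dom B"
    and K: "\<And>v b. v \<in> cball p \<rho> \<Longrightarrow> b \<in> B v \<Longrightarrow> norm b \<le> K"
    using locally_bounded_interior[OF assms(2) p(2)] by metis
  \<comment> \<open>Only A is shifted in the dual space, by its value c at p. The sum is then
    shifted by c as well, so the element to be split is z' - c.\<close>
  interpret S: normalised_sum "shift_op p c A" "shift_op p 0 B" \<rho> K
  proof
    show "maximally_monotone (shift_op p c A)" "type_FPV (shift_op p c A)"
      "maximally_monotone (shift_op p 0 B)"
      by (intro maximally_monotone_shift type_FPV_shift assms)+
    show "0 \<in> shift_op p c A 0" using c by (simp add: shift_op_def)
    show "\<rho> > 0" by fact
    fix y :: 'a and r :: real
    assume y: "shift_op p c A y \<noteq> {}" and r: "0 \<le> r" "r \<le> 1"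
    have "(1 - r) *\<^sub>R p + r *\<^sub>R (y + p) \<in> closed_segment p (y + p)" using r by (auto simp: in_segment)
    moreover have "y + p \<in> op_dom A" using y by (auto simp: shift_op_def op_dom_def)
    moreover have "(1 - r) *\<^sub>R p + r *\<^sub>R (y + p) = r *\<^sub>R y + p" by (simp add: algebra_simps)
    ultimately have "r *\<^sub>R y + p \<in> op_dom A" using seg by (metis subsetD)
    then obtain a where "a \<in> A (r *\<^sub>R y + p)" by (auto simp: op_dom_def)
    then have "a - c \<in> shift_op p c A (r *\<^sub>R y)" by (simp add: shift_op_def)
    then show "shift_op p c A (r *\<^sub>R y) \<noteq> {}" by blast
  next
    fix v :: 'a assume "norm v \<le> \<rho>"
    then have v: "v + p \<in> cball p \<rho>" by (simp add: dist_norm)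
    then have "v + p \<in> op_dom B" using \<rho> by blast
    then show "shift_op p 0 B v \<noteq> {}" by (simp add: shift_op_def op_dom_def)
    show "norm b \<le> K" if "b \<in> shift_op p 0 B v" for b
      using K[OF v] that by (simp add: shift_op_def)
  qed
  show ?thesis
    unfolding maximally_monotone_iff
  proof (intro conjI allI ballI impI)
    fix x y s t assume "s \<in> sum_op A B x" "t \<in> sum_op A B y"
    then obtain a b a' b' where st: "s = a + b" "t = a' + b'"
      and ab: "a \<in> A x" "b \<in> B x" "a' \<in> A y" "b' \<in> B y"
      by (auto simp: sum_op_def)
    have "s - t = (a - a') + (b - b')" by (simp add: st)
    then have "blinfun_apply (s - t) (x - y) = blinfun_apply (a - a') (x - y) + blinfun_apply (b - b') (x - y)"
      by (simp only: blinfun.add_left)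
    then show "0 \<le> blinfun_apply (s - t) (x - y)"
      using maximally_monotoneD(1)[OF assms(1) ab(1,3)] maximally_monotoneD(1)[OF assms(2) ab(2,4)]
      by simp
  next
    fix z z' assume rel: "\<forall>y. \<forall>b\<in>sum_op A B y. 0 \<le> blinfun_apply (z' - b) (z - y)"
    obtain a b where ab: "a \<in> shift_op p c A (z - p)" "b \<in> shift_op p 0 B (z - p)" "z' - c = a + b"
    proof (rule S.sum_maximal)
      fix y a b assume "a \<in> shift_op p c A y" "b \<in> shift_op p 0 B y"
      then have "(a + c) + b \<in> sum_op A B (y + p)" by (auto simp: shift_op_def sum_op_def)
      with rel have "0 \<le> blinfun_apply (z' - ((a + c) + b)) (z - (y + p))" by blast
      then show "0 \<le> blinfun_apply (z' - c - a - b) (z - p - y)" by (simp add: algebra_simps)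
    qed
    have "z' = (a + c) + b" using ab(3) by (simp add: algebra_simps)
    then show "z' \<in> sum_op A B z" using ab(1,2) by (auto simp: shift_op_def sum_op_def)
  qed
qed

end
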